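(* Let $\alpha$ be a nonzero algebraic number and $T$ a positive real number. Then there exists a finite set $\mathcal X\subseteq\mathcal X(\mathbb R)$ such that $M_t(\alpha)=\min\{\|\mathbf x\|_t:\mathbf x\in\mathcal X\}$ for all $t\in(0,T]$.
   Context: For a nonzero algebraic number $\alpha$, $M(\alpha)$ is the logarithmic Mahler measure of its minimal polynomial $a\prod_n(z-\alpha_n)$ over $\mathbb Z$: $M(\alpha)=\log|a|+\sum_n\log^+|\alpha_n|$. For $t\in(0,\infty)$, $M_t(\alpha)=\inf(\sum_{n=1}^N M(\alpha_n)^t)^{1/t}$, the infimum over all factorizations $\alpha=\alpha_1\cdots\alpha_N$ with $\alpha_n\in\overline{\mathbb Q}^{\times}$. $\mathcal X(\mathbb R)$ is the set of real sequences $\mathbf x=(x_1,x_2,\dots)$ with $x_n=0$ for all but finitely many $n$, and $\|\mathbf x\|_t=(\sum_n|x_n|^t)^{1/t}$. *)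

theory Defs
  imports "HOL-Analysis.Analysis" "HOL-Computational_Algebra.Computational_Algebra"
begin

text \<open>
  Algebraic numbers are taken inside the complex numbers.  The minimal polynomial over the integers
  is irreducible in \<open>\<int>[z]\<close>, hence primitive; its sign is fixed by a positive leading coefficient.
  It exists and is unique by \<open>is_int_minpoly_ex1\<close> below.
\<close>

definition is_int_minpoly :: "complex \<Rightarrow> int poly \<Rightarrow> bool" where
  "is_int_minpoly \<alpha> p \<longleftrightarrow>
     irreducible p \<and> lead_coeff p > 0 \<and> poly (map_poly of_int p) \<alpha> = 0"

definition int_minpoly :: "complex \<Rightarrow> int poly" where
  "int_minpoly \<alpha> = (THE p. is_int_minpoly \<alpha> p)"

definition log_plus :: "real \<Rightarrow> real" where
  "log_plus x = ln (max 1 x)"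

definition log_mahler :: "complex \<Rightarrow> real" where
  "log_mahler \<alpha> =
     ln \<bar>real_of_int (lead_coeff (int_minpoly \<alpha>))\<bar> +
     (\<Sum>\<beta>\<in>#proots (map_poly of_int (int_minpoly \<alpha>)). log_plus (cmod \<beta>))"

definition factorizations :: "complex \<Rightarrow> complex list set" where
  "factorizations \<alpha> =
     {as. as \<noteq> [] \<and> (\<forall>a\<in>set as. algebraic a \<and> a \<noteq> 0) \<and> prod_list as = \<alpha>}"

text \<open>
  Since \<open>0 powr t = 0\<close>, the function \<open>powr\<close> with a positive exponent is the usual real power on all
  of \<open>[0,\<infinity>)\<close>.
\<close>

definition metric_mahler :: "real \<Rightarrow> complex \<Rightarrow> real" where
  "metric_mahler t \<alpha> =
     (INF as\<in>factorizations \<alpha>. (\<Sum>a\<leftarrow>as. log_mahler a powr t) powr (1 / t))"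

text \<open>Sequences are indexed from \<open>0\<close> instead of \<open>1\<close>.\<close>

definition fin_supp_seqs :: "(nat \<Rightarrow> real) set" where
  "fin_supp_seqs = {x. finite {n. x n \<noteq> 0}}"

definition seq_norm :: "real \<Rightarrow> (nat \<Rightarrow> real) \<Rightarrow> real" where
  "seq_norm t x = (\<Sum>n | x n \<noteq> 0. \<bar>x n\<bar> powr t) powr (1 / t)"


lemma of_int_poly_mult:
  "map_poly of_int (p * q) = (map_poly of_int p * map_poly of_int q :: complex poly)"
  by (intro poly_eqI) (simp add: coeff_map_poly coeff_mult)

lemma of_int_poly_add:
  "map_poly of_int (p + q) = (map_poly of_int p + map_poly of_int q :: complex poly)"
  by (intro poly_eqI) (simp add: coeff_map_poly)

lemma of_int_poly_smult:
  "map_poly of_int (smult c p) = (smult (of_int c) (map_poly of_int p) :: complex poly)"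
  by (intro poly_eqI) (simp add: coeff_map_poly)

lemma algebraic_int_poly_ex:
  assumes "algebraic (\<alpha> :: complex)"
  shows "\<exists>p :: int poly. p \<noteq> 0 \<and> poly (map_poly of_int p) \<alpha> = 0"
proof -
  obtain q where q: "\<And>i. coeff q i \<in> \<int>" "q \<noteq> 0" "poly q \<alpha> = 0"
    using algebraicE[OF assms] by blast
  define p :: "int poly" where "p = map_poly floor (map_poly Re q)"
  have eq: "map_poly of_int p = q"
  proof (intro poly_eqI)
    fix i
    obtain k where "coeff q i = of_int k" using q(1)[of i] by (auto elim: Ints_cases)
    then show "coeff (map_poly of_int p) i = coeff q i"
      by (simp add: p_def coeff_map_poly)
  qed
  with q show ?thesis by (intro exI[of _ p]) auto
qed

lemma is_int_minpoly_ex1: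
  assumes "algebraic \<alpha>"
  shows "\<exists>!p. is_int_minpoly \<alpha> p"
proof -
  let ?R = "\<lambda>p :: int poly. p \<noteq> 0 \<and> poly (map_poly of_int p) \<alpha> = 0"
  obtain p1 where p1: "?R p1" and p1_min: "\<And>q. ?R q \<Longrightarrow> degree p1 \<le> degree q"
    using ex_has_least_nat[of ?R _ degree] algebraic_int_poly_ex[OF assms] by blast
  define p where "p = smult (sgn (lead_coeff p1)) (primitive_part p1)"
  have sgn0: "sgn (lead_coeff p1) \<noteq> 0" using p1 by (simp add: sgn_0_0)
  have p1_eq: "p1 = smult (content p1) (primitive_part p1)" by simp
  have cpos: "content p1 > 0"
    by (metis content_eq_zero_iff normalize_content abs_ge_zero normalize_int_def order_le_less p1)
  have deg_p: "degree p = degree p1" using sgn0 by (simp add: p_def)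
  have "poly (map_poly of_int (smult (content p1) (primitive_part p1))) \<alpha> = 0"
    using p1 by simp
  then have root_p: "poly (map_poly of_int p) \<alpha> = 0"
    using cpos p1 by (auto simp: p_def of_int_poly_smult simp del: content_times_primitive_part)
  have p0: "p \<noteq> 0" using p1 sgn0 by (simp add: p_def)
  have cont_p: "content p = 1"
    using p1 sgn0 by (auto simp: p_def sgn_if split: if_splits)
  have "lead_coeff p1 = content p1 * lead_coeff (primitive_part p1)"
    by (metis p1_eq lead_coeff_smult)
  then have lc_p: "lead_coeff p > 0"
    using cpos p1 by (auto simp: p_def sgn_if zero_less_mult_iff mult_less_0_iff split: if_splits)
  have minp: "degree p \<le> degree q" if "?R q" for q
    using p1_min[OF that] deg_p by simp
  have dvd: "p dvd q" if q: "poly (map_poly of_int q) \<alpha> = 0" for q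
  proof -
    obtain a s where as: "a \<noteq> 0" "smult a q = p * s + pseudo_mod q p"
      using pseudo_mod(1)[OF p0] by blast
    have "poly (map_poly of_int (smult a q)) \<alpha> = 0" using q by (simp add: of_int_poly_smult)
    then have "poly (map_poly of_int (pseudo_mod q p)) \<alpha> = 0"
      using root_p unfolding as(2) by (simp add: of_int_poly_add of_int_poly_mult)
    then have "pseudo_mod q p = 0"
      using pseudo_mod(2)[OF p0, of q] minp[of "pseudo_mod q p"] by force
    then have eq: "smult a q = p * s" using as by simp
    have "a dvd content (smult a q)" by simp
    then have "a dvd content s" by (simp add: eq content_mult cont_p)
    then have "[:a:] dvd s" by (simp add: const_poly_dvd_iff_dvd_content)
    then obtain s' where "s = smult a s'" by (auto elim!: dvdE)
    then have "smult a (q - p * s') = 0" using eq by (simp add: smult_diff_right)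
    then have "q = p * s'" using as(1) by simp
    then show ?thesis by simp
  qed
  have deg_pos: "degree p \<noteq> 0"
  proof
    assume "degree p = 0"
    then obtain c where "p = [:c:]" by (elim degree_eq_zeroE)
    then show False using root_p p0 by (simp add: map_poly_pCons)
  qed
  have unit: "b dvd 1" if ab: "p = a * b" and a: "poly (map_poly of_int a) \<alpha> = 0" for a b
  proof -
    have nz: "a \<noteq> 0" "b \<noteq> 0" using ab p0 by auto
    have "degree b = 0" using minp[of a] a nz ab by (simp add: degree_mult_eq)
    then obtain c where c: "b = [:c:]" by (elim degree_eq_zeroE)
    have "c dvd content p" using ab c by (simp flip: const_poly_dvd_iff_dvd_content)
    then show ?thesis using c cont_p by (simp add: is_unit_const_poly_iff)
  qed
  have irr: "irreducible p"
  proof (rule irreducibleI)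
    show "p \<noteq> 0" by fact
    show "\<not> p dvd 1" using deg_pos by (auto simp: is_unit_poly_iff)
    fix a b assume ab: "p = a * b"
    then have "poly (map_poly of_int a) \<alpha> = 0 \<or> poly (map_poly of_int b) \<alpha> = 0"
      using root_p by (simp add: of_int_poly_mult)
    then show "a dvd 1 \<or> b dvd 1"
      using unit[of a b] unit[of b a] ab by (auto simp: mult.commute)
  qed
  show ?thesis
  proof
    show "is_int_minpoly \<alpha> p" using irr lc_p root_p by (simp add: is_int_minpoly_def)
    fix q assume q: "is_int_minpoly \<alpha> q"
    then obtain s where s: "q = p * s" using dvd[of q] by (auto simp: is_int_minpoly_def elim: dvdE)
    have "s dvd 1"
      using q irreducibleD[OF _ s] irreducible_not_unit[OF irr] by (auto simp: is_int_minpoly_def)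
    then obtain c where c: "s = [:c:]" "c dvd 1" by (auto simp: is_unit_poly_iff)
    have "c > 0" using q lc_p c(1) s
      by (auto simp: is_int_minpoly_def zero_less_mult_iff mult.commute)
    then have "c = 1" using c(2) by simp
    then show "q = p" using s c by simp
  qed
qed

lemma is_int_minpoly_int_minpoly:
  assumes "algebraic \<alpha>"
  shows "is_int_minpoly \<alpha> (int_minpoly \<alpha>)"
  unfolding int_minpoly_def by (rule theI') (rule is_int_minpoly_ex1[OF assms])

end

theory Submission
  imports Defs "Jordan_Normal_Form.Char_Poly"
begin

text \<open>
  Let \<open>G\<close> be the automorphism group of the field of algebraic numbers and \<open>H\<close> the normal subgroup of
  finite index that fixes all conjugates of \<open>\<alpha>\<close>. The conjugates of an algebraic number \<open>a\<close> fall into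
  \<open>H\<close>-orbits (blocks), at most \<open>[G : H]\<close> many. If \<open>c\<close> is the leading coefficient of the minimal
  polynomial of \<open>a\<close>, then \<open>P(x) = c \<Prod>\<^sub>B (x - \<Prod>B)\<close> has integer coefficients and a Mahler measure not
  exceeding that of \<open>a\<close>. If \<open>\<beta>\<close> is a \<open>d\<close>-th root of the product of the block of \<open>a\<close>, where \<open>d\<close> is the
  size of that block, then \<open>\<beta>\<close> is a root of \<open>P(x\<^sup>d)\<close>, which has the same Mahler measure as \<open>P\<close>; hence
  \<open>M(\<beta>) \<le> M(a)\<close>. Taking norms with respect to \<open>H\<close> turns a factorization \<open>\<alpha> = a\<^sub>1 \<cdots> a\<^sub>N\<close> into
  \<open>\<alpha> = \<zeta> \<beta>\<^sub>1 \<cdots> \<beta>\<^sub>N\<close> with a root of unity \<open>\<zeta>\<close>.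

  Since a power of \<open>\<beta>\<close> is fixed by \<open>H\<close>, the absolute value is constant on each block of \<open>\<beta>\<close>, so \<open>M(\<beta>)\<close>
  equals the Mahler measure of the polynomial \<open>P\<close> belonging to \<open>\<beta>\<close>. The degree of that integer
  polynomial is bounded independently of \<open>\<beta>\<close>, so only finitely many values of \<open>M(\<beta>)\<close> lie below
  \<open>M(\<alpha>)\<close>. For \<open>t \<le> T\<close> the number of nonzero terms in a factorization that does not lose against the
  trivial one is bounded as well, which leaves finitely many sequences.
\<close>

section \<open>Algebraic integers\<close>

text \<open>Finitely generated additive groups serve as the test for integrality: a number that maps
  a nonzero one into itself is an algebraic integer.\<close>

interpretation Zmod: Modules.module "\<lambda>k (x :: complex). of_int k * x"
  by unfold_locales (auto simp: algebra_simps)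

lemma Zspan_finite_conv:
  assumes "finite B"
  shows "x \<in> Zmod.span B \<longleftrightarrow> (\<exists>f. x = (\<Sum>b\<in>B. of_int (f b) * b))"
  using assms by (auto simp: Zmod.span_finite)

lemma Zspan_mult_left:
  assumes "x \<in> Zmod.span B" "\<And>b. b \<in> B \<Longrightarrow> y * b \<in> Zmod.span C"
  shows "y * x \<in> Zmod.span C"
  using assms(1)
proof (induction rule: Zmod.span_induct_alt)
  case base
  then show ?case by (simp add: Zmod.span_zero)
next
  case (step c x y')
  have "y * (of_int c * x + y') = of_int c * (y * x) + y * y'"
    by (simp add: algebra_simps)
  then show ?case
    using step assms(2) by (metis Zmod.span_add Zmod.span_scale)
qed

text \<open>The determinant trick. Expressing each \<open>z * b\<close> through \<open>B\<close>
  gives an integer matrix with eigenvalue \<open>z\<close>, the elements of \<open>B\<close> forming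
  an eigenvector. Hence \<open>z\<close> is a root of the monic characteristic polynomial;
  \<open>b0\<close> ensures that the eigenvector is not zero.\<close>

lemma algebraic_int_if_Zspan_stable:
  assumes B: "finite B" "b0 \<in> B" "b0 \<noteq> 0"
    and stable: "\<And>b. b \<in> B \<Longrightarrow> z * b \<in> Zmod.span B"
  shows "algebraic_int (z :: complex)"
proof -
  define n where "n = card B"
  obtain h where h: "bij_betw h {0..<n} B"
    using ex_bij_betw_nat_finite[OF B(1)] by (auto simp: n_def)
  have "\<forall>b\<in>B. \<exists>f. z * b = (\<Sum>b'\<in>B. of_int (f b') * b')"
    using stable B(1) by (auto simp: Zspan_finite_conv)
  then obtain f where f: "\<And>b. b \<in> B \<Longrightarrow> z * b = (\<Sum>b'\<in>B. of_int (f b b') * b')"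
    by metis
  define A :: "int mat" where "A = mat n n (\<lambda>(i, j). f (h i) (h j))"
  define v :: "complex vec" where "v = Matrix.vec n h"
  let ?A = "map_mat of_int A :: complex mat"
  have A: "A \<in> carrier_mat n n" and A': "?A \<in> carrier_mat n n" by (auto simp: A_def)
  have hB: "h i \<in> B" if "i < n" for i
    using h that by (auto simp: bij_betw_def)
  have "?A *\<^sub>v v = z \<cdot>\<^sub>v v"
  proof (rule eq_vecI)
    fix i assume "i < dim_vec (z \<cdot>\<^sub>v v)"
    then have i: "i < n" by (simp add: v_def)
    have "(?A *\<^sub>v v) $ i = (\<Sum>j = 0..<n. of_int (f (h i) (h j)) * h j)"
      using i by (simp add: A_def v_def scalar_prod_def)
    also have "\<dots> = (\<Sum>b'\<in>B. of_int (f (h i) b') * b')"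
      by (rule sum.reindex_bij_betw[OF h])
    also have "\<dots> = (z \<cdot>\<^sub>v v) $ i"
      using f[OF hB[OF i]] i by (simp add: v_def)
    finally show "(?A *\<^sub>v v) $ i = (z \<cdot>\<^sub>v v) $ i" .
  qed (auto simp: v_def A_def)
  moreover have "v \<noteq> 0\<^sub>v n"
  proof
    assume v0: "v = 0\<^sub>v n"
    obtain i where "i < n" "h i = b0"
      using h B(2) unfolding bij_betw_def by force
    then have "v $ i = b0" by (simp add: v_def)
    then show False using v0 B(3) \<open>i < n\<close> by simp
  qed
  ultimately have "eigenvalue ?A z"
    unfolding eigenvalue_def eigenvector_def using A by (auto simp: v_def intro!: exI[of _ v])
  then have "poly (char_poly ?A) z = 0"
    using eigenvalue_root_char_poly[OF A'] by simp
  then have "poly (map_poly of_int (char_poly A)) z = 0"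
    using of_int_hom.char_poly_hom[OF A, where 'a = complex] by simp
  moreover have "lead_coeff (char_poly A) = 1"
    using degree_monic_char_poly[OF A] by simp
  ultimately show ?thesis
    unfolding algebraic_int_altdef_ipoly by blast
qed

text \<open>\<open>C\<close> adjoins the powers of \<open>z\<close> below \<open>n\<close>; its span
  is stable under \<open>z\<close> because the relation rewrites \<open>z ^ n\<close>. The last
  conclusion carries the stabilizers of the old group over to the new one, so several numbers can be
  adjoined in turn.\<close>

lemma Zspan_adjoin_root:
  assumes B: "finite B" "1 \<in> B"
    and c: "\<And>i b. i < n \<Longrightarrow> b \<in> B \<Longrightarrow> c i * b \<in> Zmod.span B"
    and z: "z ^ n = (\<Sum>i<n. c i * z ^ i)" and n: "n > 0"
  defines "C \<equiv> (\<lambda>(b, j). b * z ^ j) ` (B \<times> {..<n})"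
  shows "finite C" "1 \<in> C" "\<And>b. b \<in> C \<Longrightarrow> z * b \<in> Zmod.span C"
    "\<And>y b. (\<And>b. b \<in> B \<Longrightarrow> y * b \<in> Zmod.span B) \<Longrightarrow> b \<in> C \<Longrightarrow> y * b \<in> Zmod.span C"
proof -
  show "finite C" using B by (simp add: C_def)
  show "1 \<in> C" using B n by (force simp: C_def)
  have lift: "x * z ^ j \<in> Zmod.span C" if "x \<in> Zmod.span B" "j < n" for x j
  proof -
    have "z ^ j * x \<in> Zmod.span C"
      using that(1)
    proof (rule Zspan_mult_left)
      fix b assume "b \<in> B"
      then have "b * z ^ j \<in> C" using that(2) by (force simp: C_def)
      then show "z ^ j * b \<in> Zmod.span C" by (subst mult.commute) (rule Zmod.span_base)
    qed
    then show ?thesis by (subst mult.commute)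
  qed
  show "y * b \<in> Zmod.span C" if y: "\<And>b. b \<in> B \<Longrightarrow> y * b \<in> Zmod.span B" and "b \<in> C" for y b
  proof -
    obtain b' j where b': "b = b' * z ^ j" "b' \<in> B" "j < n" using \<open>b \<in> C\<close> by (auto simp: C_def)
    then show ?thesis using lift[OF y[OF b'(2)] b'(3)] by (simp add: mult.assoc)
  qed
  show "z * b \<in> Zmod.span C" if "b \<in> C" for b
  proof -
    obtain b' j where b': "b = b' * z ^ j" "b' \<in> B" "j < n" using \<open>b \<in> C\<close> by (auto simp: C_def)
    show ?thesis
    proof (cases "Suc j < n")
      case True
      then show ?thesis
        using lift[OF Zmod.span_base[OF b'(2)], of "Suc j"] by (simp add: b' mult_ac)
    next
      case False
      then have "n = Suc j" using b' by simp
      then have "z * b = b' * z ^ n" by (simp add: b')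
      also have "\<dots> = (\<Sum>i<n. (c i * b') * z ^ i)"
        by (simp add: z sum_distrib_left mult_ac)
      also have "\<dots> \<in> Zmod.span C"
        by (rule Zmod.span_sum) (use lift c b' in auto)
      finally show ?thesis .
    qed
  qed
qed

lemma algebraic_int_monic_relation:
  assumes "algebraic_int (z :: complex)"
  obtains n :: nat and c :: "nat \<Rightarrow> int"
  where "n > 0" "z ^ n = (\<Sum>i<n. of_int (c i) * z ^ i)"
proof -
  obtain p :: "int poly" where p: "poly (map_poly of_int p) z = 0" "lead_coeff p = 1"
    using assms unfolding algebraic_int_altdef_ipoly by auto
  have "degree p > 0"
  proof (rule ccontr)
    assume "\<not> degree p > 0"
    then obtain k where "p = [:k:]" by (auto elim: degree_eq_zeroE)
    then show False using p by (simp add: map_poly_pCons)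
  qed
  moreover have "0 = (\<Sum>i\<le>degree p. of_int (coeff p i) * z ^ i)"
    using p by (simp add: poly_altdef degree_map_poly coeff_map_poly)
  then have "0 = (\<Sum>i<degree p. of_int (coeff p i) * z ^ i) + z ^ degree p"
    using p by (simp flip: lessThan_Suc_atMost)
  then have "z ^ degree p = (\<Sum>i<degree p. of_int (- coeff p i) * z ^ i)"
    by (simp add: sum_negf eq_neg_iff_add_eq_0 add.commute)
  ultimately show ?thesis by (intro that[of "degree p" "\<lambda>i. - coeff p i"])
qed

lemma algebraic_ints_common_Zspan:
  assumes "finite Y" "\<And>y. y \<in> Y \<Longrightarrow> algebraic_int (y :: complex)"
  shows "\<exists>B. finite B \<and> 1 \<in> B \<and> (\<forall>y\<in>Y. \<forall>b\<in>B. y * b \<in> Zmod.span B)"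
  using assms
proof (induction rule: finite_induct)
  case empty
  then show ?case by (intro exI[of _ "{1}"]) auto
next
  case (insert y Y)
  then obtain B where B: "finite B" "1 \<in> B" "\<forall>y\<in>Y. \<forall>b\<in>B. y * b \<in> Zmod.span B" by auto
  obtain n c where nc: "n > 0" "y ^ n = (\<Sum>i<n. of_int (c i) * y ^ i)"
    using algebraic_int_monic_relation insert.prems by blast
  have c: "of_int (c i) * b \<in> Zmod.span B" if "i < n" "b \<in> B" for i b
    using that by (intro Zmod.span_scale Zmod.span_base)
  note adj = Zspan_adjoin_root[OF B(1,2) c nc(2,1)]
  show ?case
    by (rule exI[of _ "(\<lambda>(b, j). b * y ^ j) ` (B \<times> {..<n})"])
      (use adj B(3) in blast)
qed

text \<open>First a group stable under all \<open>c i\<close> is built, then \<open>z\<close> is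
  adjoined to it; the enlarged group is stable under \<open>z\<close>.\<close>

lemma algebraic_int_integrally_closed:
  assumes "\<And>i. i < n \<Longrightarrow> algebraic_int (c i)" "n > 0"
    and "z ^ n = (\<Sum>i<n. c i * z ^ i)"
  shows "algebraic_int (z :: complex)"
proof -
  obtain B where B: "finite B" "1 \<in> B" "\<forall>y\<in>c ` {..<n}. \<forall>b\<in>B. y * b \<in> Zmod.span B"
    using algebraic_ints_common_Zspan[of "c ` {..<n}"] assms(1) by auto
  have c: "c i * b \<in> Zmod.span B" if "i < n" "b \<in> B" for i b
    using B(3) that by auto
  note adj = Zspan_adjoin_root[OF B(1,2) c assms(3,2)]
  show ?thesis
    by (rule algebraic_int_if_Zspan_stable[OF adj(1,2)]) (use adj(3) in auto)
qed

text \<open>Both numbers stabilize a common finitely generated group, hence so do their sum and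
  product.\<close>

lemma algebraic_int_plus_times:
  assumes "algebraic_int (x :: complex)" "algebraic_int y"
  shows algebraic_int_plus: "algebraic_int (x + y)"
    and algebraic_int_times: "algebraic_int (x * y)"
proof -
  obtain B where B: "finite B" "1 \<in> B" "\<forall>u\<in>{x, y}. \<forall>b\<in>B. u * b \<in> Zmod.span B"
    using algebraic_ints_common_Zspan[of "{x, y}"] assms by auto
  show "algebraic_int (x + y)"
    by (rule algebraic_int_if_Zspan_stable[OF B(1,2)])
      (use B(3) in \<open>auto simp: ring_distribs intro!: Zmod.span_add\<close>)
  have "x * y * b \<in> Zmod.span B" if "b \<in> B" for b
    using Zspan_mult_left[of "y * b" B x B] B(3) that by (simp add: mult.assoc)
  then show "algebraic_int (x * y)"
    by (intro algebraic_int_if_Zspan_stable[OF B(1,2)]) auto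
qed

lemma algebraic_int_of_int: "algebraic_int (of_int k :: complex)"
  by (rule int_imp_algebraic_int) auto

lemma algebraic_int_power: "algebraic_int (x :: complex) \<Longrightarrow> algebraic_int (x ^ n)"
  by (induction n) (auto intro: algebraic_int_times)

text \<open>Multiplying a polynomial relation by a power of its leading coefficient makes it monic.\<close>

lemma algebraic_int_lead_coeff_times_root:
  assumes "\<And>i. algebraic_int (coeff f i)" "poly f a = 0" "f \<noteq> 0"
  shows "algebraic_int (lead_coeff f * (a :: complex))"
proof -
  define n where "n = degree f"
  define l where "l = lead_coeff f"
  have l: "algebraic_int l" "coeff f n = l" using assms by (auto simp: l_def n_def)
  have n: "n > 0"
  proof (rule ccontr)
    assume "\<not> n > 0"
    then obtain k where "f = [:k:]" by (auto simp: n_def elim: degree_eq_zeroE)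
    then show False using assms by simp
  qed
  have "0 = l ^ (n - 1) * (\<Sum>i\<le>n. coeff f i * a ^ i)"
    using assms(2) by (simp add: poly_altdef n_def)
  also have "\<dots> = (\<Sum>i\<le>n. l ^ (n - 1) * coeff f i * a ^ i)"
    by (simp add: sum_distrib_left mult_ac)
  also have "\<dots> = (\<Sum>i<n. l ^ (n - 1) * coeff f i * a ^ i) + l ^ (n - 1) * l * a ^ n"
    by (simp add: l flip: lessThan_Suc_atMost)
  also have "l ^ (n - 1) * l * a ^ n = (l * a) ^ n"
    using n by (simp add: power_mult_distrib flip: power_Suc2)
  also have "(\<Sum>i<n. l ^ (n - 1) * coeff f i * a ^ i) =
      (\<Sum>i<n. (coeff f i * l ^ (n - 1 - i)) * (l * a) ^ i)"
  proof (rule sum.cong[OF refl])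
    fix i assume "i \<in> {..<n}"
    then have "l ^ (n - 1) = l ^ (n - 1 - i) * l ^ i" by (simp flip: power_add)
    then show "l ^ (n - 1) * coeff f i * a ^ i = (coeff f i * l ^ (n - 1 - i)) * (l * a) ^ i"
      by (simp add: power_mult_distrib)
  qed
  finally have "(l * a) ^ n = (\<Sum>i<n. - (coeff f i * l ^ (n - 1 - i)) * (l * a) ^ i)"
    by (simp add: sum_negf eq_neg_iff_add_eq_0 add.commute)
  moreover have "algebraic_int (- (coeff f i * l ^ (n - 1 - i)))" for i
    using assms(1) l(1) by (auto intro: algebraic_int_times algebraic_int_power)
  ultimately show ?thesis
    unfolding l_def[symmetric]
    using algebraic_int_integrally_closed[OF _ n, of "\<lambda>i. - (coeff f i * l ^ (n - 1 - i))" "l * a"]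
    by blast
qed

text \<open>Induction on the degree of \<open>g\<close>. If \<open>l\<close> is its leading
  coefficient, then \<open>l\<close> and \<open>l * a\<close> are algebraic integers, so subtracting
  \<open>[:- a, 1:]\<close> times the leading monomial of \<open>g\<close> keeps all coefficients
  integral and leaves a smaller cofactor \<open>h\<close>.\<close>

lemma algebraic_int_coeffs_remove_root:
  assumes "\<And>i. algebraic_int (coeff ([:- a, 1:] * g) i)"
  shows "algebraic_int (coeff g i :: complex)"
  using assms
proof (induction "degree g" arbitrary: g i rule: less_induct)
  case less
  show ?case
  proof (cases "g = 0")
    case False
    let ?f = "[:- a, 1:] * g" and ?m = "monom (lead_coeff g) (degree g)"
    define h where "h = g - ?m"
    have lead: "lead_coeff ?f = lead_coeff g" by (simp add: lead_coeff_mult del: mult_pCons_left)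
    have alg: "algebraic_int (lead_coeff g * a)"
      using algebraic_int_lead_coeff_times_root[of ?f a] less.prems False lead
      by (simp del: mult_pCons_left)
    have lg: "algebraic_int (lead_coeff g)"
      using less.prems lead by metis
    have "algebraic_int (coeff ([:- a, 1:] * ?m) i)" for i
      using alg lg by (auto simp: coeff_pCons mult.commute split: nat.splits)
    moreover have "[:- a, 1:] * h = ?f + - ([:- a, 1:] * ?m)"
      by (simp add: h_def algebra_simps)
    ultimately have hi: "algebraic_int (coeff ([:- a, 1:] * h) i)" for i
      using less.prems[of i]
      by (simp only: coeff_add coeff_minus) (intro algebraic_int_plus algebraic_int_minus)
    have "algebraic_int (coeff h i)"
    proof (cases "degree g = 0")
      case True
      then have "h = 0" by (auto simp: h_def monom_0 elim: degree_eq_zeroE)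
      then show ?thesis by simp
    next
      case dg: False
      have "degree h < degree g"
      proof (rule degree_lessI)
        show "\<forall>k\<ge>degree g. coeff h k = 0"
          by (auto simp: h_def coeff_eq_0)
      qed (use dg in auto)
      then show ?thesis using less.hyps hi by blast
    qed
    moreover have "coeff g i = coeff h i + coeff ?m i" by (simp add: h_def)
    moreover have "algebraic_int (coeff ?m i)" using lg by auto
    ultimately show ?thesis using algebraic_int_plus by metis
  qed simp
qed

section \<open>Closure properties of algebraic numbers\<close>

lemma algebraic_imp_int_multiple:
  assumes "algebraic (x :: complex)"
  obtains k :: int where "k \<noteq> 0" "algebraic_int (of_int k * x)"
proof -
  obtain p :: "int poly" where p: "p \<noteq> 0" "poly (map_poly of_int p) x = 0"
    using algebraicE'[OF assms] by blast
  have "algebraic_int (lead_coeff (map_poly of_int p) * x)"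
    using p by (intro algebraic_int_lead_coeff_times_root)
      (auto simp: coeff_map_poly algebraic_int_of_int)
  then show ?thesis using that[of "lead_coeff p"] p
    by (simp add: degree_map_poly coeff_map_poly)
qed

lemma algebraic_if_int_multiple:
  assumes "k \<noteq> 0" "algebraic_int (of_int k * (x :: complex))"
  shows "algebraic x"
proof -
  obtain p :: "complex poly" where p: "lead_coeff p = 1" "\<forall>i. coeff p i \<in> \<int>" "poly p (of_int k * x) = 0"
    using assms(2) by (auto elim: algebraic_int.cases)
  show ?thesis
  proof (rule algebraicI)
    show "p \<circ>\<^sub>p [:0, of_int k:] \<noteq> 0"
      using p(1) assms(1) by (auto simp: pcompose_eq_0_iff)
    show "poly (p \<circ>\<^sub>p [:0, of_int k:]) x = 0"
      using p by (simp add: poly_pcompose mult.commute)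
    show "coeff (p \<circ>\<^sub>p [:0, of_int k:]) i \<in> \<int>" for i
      using p by (intro coeff_pcompose_semiring_closed) (auto simp: coeff_pCons split: nat.splits)
  qed
qed

text \<open>Scaling by nonzero integers reduces the claim to algebraic integers.\<close>

lemma algebraic_plus_times:
  assumes "algebraic (x :: complex)" "algebraic y"
  shows algebraic_plus: "algebraic (x + y)"
    and algebraic_times: "algebraic (x * y)"
proof -
  obtain k where k: "k \<noteq> 0" "algebraic_int (of_int k * x)"
    using algebraic_imp_int_multiple assms(1) by blast
  obtain l where l: "l \<noteq> 0" "algebraic_int (of_int l * y)"
    using algebraic_imp_int_multiple assms(2) by blast
  have "of_int (k * l) * (x + y) = of_int l * (of_int k * x) + of_int k * (of_int l * y)"
    by (simp add: algebra_simps)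
  then have "algebraic_int (of_int (k * l) * (x + y))"
    using k l by (metis algebraic_int_plus algebraic_int_times algebraic_int_of_int)
  then show "algebraic (x + y)" using k l by (intro algebraic_if_int_multiple[of "k * l"]) auto
  have "of_int (k * l) * (x * y) = (of_int k * x) * (of_int l * y)"
    by (simp add: algebra_simps)
  then have "algebraic_int (of_int (k * l) * (x * y))"
    using k l by (metis algebraic_int_times)
  then show "algebraic (x * y)" using k l by (intro algebraic_if_int_multiple[of "k * l"]) auto
qed

lemma algebraic_prod:
  "(\<And>i. i \<in> I \<Longrightarrow> algebraic (f i :: complex)) \<Longrightarrow> algebraic (prod f I)"
  by (induction I rule: infinite_finite_induct) (auto intro: algebraic_times)

lemma algebraic_sum:
  "(\<And>i. i \<in> I \<Longrightarrow> algebraic (f i :: complex)) \<Longrightarrow> algebraic (sum f I)"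
  by (induction I rule: infinite_finite_induct) (auto intro: algebraic_plus)

lemma algebraic_power: "algebraic (x :: complex) \<Longrightarrow> algebraic (x ^ n)"
  by (induction n) (auto intro: algebraic_times)

lemma algebraic_if_power:
  assumes "algebraic ((x :: complex) ^ n)" "n > 0"
  shows "algebraic x"
  by (rule algebraic_root[OF assms(1), of "monom 1 n"])
    (use assms in \<open>auto simp: poly_monom degree_monom_eq\<close>)

section \<open>Automorphisms of the field of algebraic numbers\<close>

text \<open>Partial homomorphisms of the field of algebraic numbers are represented by their graphs.\<close>

definition partial_hom :: "(complex \<times> complex) set \<Rightarrow> bool" where
  "partial_hom \<Gamma> \<longleftrightarrow>
     (\<forall>q\<in>\<rat>. (q, q) \<in> \<Gamma>) \<and>
     (\<forall>x y x' y'. (x, y) \<in> \<Gamma> \<longrightarrow> (x', y') \<in> \<Gamma> \<longrightarrow> (x + x', y + y') \<in> \<Gamma>) \<and>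
     (\<forall>x y x' y'. (x, y) \<in> \<Gamma> \<longrightarrow> (x', y') \<in> \<Gamma> \<longrightarrow> (x * x', y * y') \<in> \<Gamma>) \<and>
     (\<forall>x y. (x, y) \<in> \<Gamma> \<longrightarrow> algebraic x) \<and>
     (\<forall>y. (0, y) \<in> \<Gamma> \<longrightarrow> y = 0)"

text \<open>\<open>g\<close> is the image of \<open>f\<close> under the homomorphism with graph \<open>\<Gamma>\<close>, applied to the coefficients.\<close>

definition ppoly :: "(complex \<times> complex) set \<Rightarrow> complex poly \<Rightarrow> complex poly \<Rightarrow> bool" where
  "ppoly \<Gamma> f g \<longleftrightarrow> (\<forall>i. (coeff f i, coeff g i) \<in> \<Gamma>)"

context
  fixes \<Gamma>
  assumes \<Gamma>: "partial_hom \<Gamma>"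
begin

lemma partial_hom_Rats: "q \<in> \<rat> \<Longrightarrow> (q, q) \<in> \<Gamma>"
  and partial_hom_add: "(x, y) \<in> \<Gamma> \<Longrightarrow> (x', y') \<in> \<Gamma> \<Longrightarrow> (x + x', y + y') \<in> \<Gamma>"
  and partial_hom_mult: "(x, y) \<in> \<Gamma> \<Longrightarrow> (x', y') \<in> \<Gamma> \<Longrightarrow> (x * x', y * y') \<in> \<Gamma>"
  and partial_hom_algebraic: "(x, y) \<in> \<Gamma> \<Longrightarrow> algebraic x"
  and partial_hom_zero: "(0, y) \<in> \<Gamma> \<Longrightarrow> y = 0"
  using \<Gamma> unfolding partial_hom_def by blast+

lemma partial_hom_minus: "(x, y) \<in> \<Gamma> \<Longrightarrow> (- x, - y) \<in> \<Gamma>"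
  using partial_hom_mult[OF partial_hom_Rats[of "- 1"], of x y] by simp

lemma partial_hom_diff: "(x, y) \<in> \<Gamma> \<Longrightarrow> (x', y') \<in> \<Gamma> \<Longrightarrow> (x - x', y - y') \<in> \<Gamma>"
  using partial_hom_add[OF _ partial_hom_minus, of x y x' y'] by simp

lemma partial_hom_unique: "(x, y) \<in> \<Gamma> \<Longrightarrow> (x, y') \<in> \<Gamma> \<Longrightarrow> y = y'"
  using partial_hom_diff[of x y x y'] partial_hom_zero[of "y - y'"] by simp

lemma partial_hom_sum:
  "(\<And>i. i \<in> I \<Longrightarrow> (f i, g i) \<in> \<Gamma>) \<Longrightarrow> (sum f I, sum g I) \<in> \<Gamma>"
  by (induction I rule: infinite_finite_induct)
    (auto intro: partial_hom_add partial_hom_Rats)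

lemma partial_hom_power: "(x, y) \<in> \<Gamma> \<Longrightarrow> (x ^ n, y ^ n) \<in> \<Gamma>"
  by (induction n) (auto intro: partial_hom_mult partial_hom_Rats)

lemma ppoly_Rats: "(\<And>i. coeff f i \<in> \<rat>) \<Longrightarrow> ppoly \<Gamma> f f"
  by (auto simp: ppoly_def partial_hom_Rats)

lemma ppoly_add: "ppoly \<Gamma> f g \<Longrightarrow> ppoly \<Gamma> f' g' \<Longrightarrow> ppoly \<Gamma> (f + f') (g + g')"
  by (auto simp: ppoly_def partial_hom_add)

lemma ppoly_diff: "ppoly \<Gamma> f g \<Longrightarrow> ppoly \<Gamma> f' g' \<Longrightarrow> ppoly \<Gamma> (f - f') (g - g')"
  by (auto simp: ppoly_def partial_hom_diff)

lemma ppoly_mult: "ppoly \<Gamma> f g \<Longrightarrow> ppoly \<Gamma> f' g' \<Longrightarrow> ppoly \<Gamma> (f * f') (g * g')"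
  unfolding ppoly_def coeff_mult
  by (intro allI partial_hom_sum partial_hom_mult) auto

lemma ppoly_monom: "(x, y) \<in> \<Gamma> \<Longrightarrow> ppoly \<Gamma> (monom x n) (monom y n)"
  by (auto simp: ppoly_def partial_hom_Rats)

lemma ppoly_poly:
  assumes "ppoly \<Gamma> f g" "(x, y) \<in> \<Gamma>"
  shows "(poly f x, poly g y) \<in> \<Gamma>"
proof -
  define n where "n = max (degree f) (degree g)"
  have *: "poly h u = (\<Sum>i\<le>n. coeff h i * u ^ i)" if "degree h \<le> n" for h and u :: complex
    unfolding poly_altdef using that by (intro sum.mono_neutral_left) (auto simp: coeff_eq_0)
  have "(\<Sum>i\<le>n. coeff f i * x ^ i, \<Sum>i\<le>n. coeff g i * y ^ i) \<in> \<Gamma>"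
    using assms by (intro partial_hom_sum partial_hom_mult partial_hom_power) (auto simp: ppoly_def)
  then show ?thesis using *[of f x] *[of g y] by (simp add: n_def)
qed

lemma partial_hom_int_root:
  assumes "(x, y) \<in> \<Gamma>" "poly (map_poly of_int p) x = 0"
  shows "poly (map_poly of_int p) y = 0"
proof -
  have "ppoly \<Gamma> (map_poly of_int p) (map_poly of_int p)"
    by (rule ppoly_Rats) (simp add: coeff_map_poly)
  from ppoly_poly[OF this assms(1)] show ?thesis
    using assms(2) partial_hom_zero by simp
qed

text \<open>Inverses are not among the closure conditions of \<open>partial_hom\<close>. An integer
  relation \<open>k + u * q(u) = 0\<close> with nonzero \<open>k\<close> exhibits
  \<open>- q(u) / k\<close> as the inverse of \<open>u\<close>, a rational polynomial expression in
  \<open>u\<close> whose image is known.\<close>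

lemma partial_hom_inverse:
  assumes "(u, v) \<in> \<Gamma>" "u \<noteq> 0"
  shows "(inverse u, inverse v) \<in> \<Gamma>"
proof -
  obtain p :: "int poly" where p: "coeff p 0 \<noteq> 0" "poly (map_poly of_int p) u = 0"
    using algebraicE'_nonzero[OF partial_hom_algebraic[OF assms(1)] assms(2)] by blast
  obtain k q where q: "p = pCons k q" by (cases p)
  have k: "k \<noteq> 0" and eq: "of_int k + u * poly (map_poly of_int q) u = 0"
    using p by (auto simp: q map_poly_pCons)
  define w where "w x = - (1 / of_int k) * poly (map_poly of_int q) x" for x :: complex
  have uw: "u * w u = 1"
  proof -
    have "u * w u = - (1 / of_int k) * (u * poly (map_poly of_int q) u)"
      by (simp add: w_def)
    also have "u * poly (map_poly of_int q) u = - of_int k"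
      using eq by (simp add: eq_neg_iff_add_eq_0 add.commute)
    finally show ?thesis using k by simp
  qed
  have "ppoly \<Gamma> (map_poly of_int q) (map_poly of_int q)"
    by (rule ppoly_Rats) (simp add: coeff_map_poly)
  then have w: "(w u, w v) \<in> \<Gamma>"
    unfolding w_def by (intro partial_hom_mult partial_hom_Rats ppoly_poly assms(1)) auto
  have "(1, v * w v) \<in> \<Gamma>" using partial_hom_mult[OF assms(1) w] uw by simp
  then have "v * w v = 1" using partial_hom_unique[OF partial_hom_Rats[of 1]] by auto
  then have "inverse v = w v" "inverse u = w u" using uw by (auto intro: inverse_unique)
  then show ?thesis using w by simp
qed

lemma partial_hom_zero_right: assumes "(u, 0) \<in> \<Gamma>" shows "u = 0"
proof (rule ccontr)
  assume "u \<noteq> 0"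
  then have "(u * inverse u, 0 * inverse 0) \<in> \<Gamma>"
    by (intro partial_hom_mult partial_hom_inverse assms)
  then have "(1, 0) \<in> \<Gamma>" using \<open>u \<noteq> 0\<close> by simp
  then show False using partial_hom_unique[OF partial_hom_Rats[of 1], of 0] by simp
qed

text \<open>A homomorphism of fields is injective, so a nonzero coefficient has a nonzero
  image.\<close>

lemma ppoly_degree:
  assumes "ppoly \<Gamma> f g" shows "degree g = degree f"
proof -
  have "coeff f i = 0 \<longleftrightarrow> coeff g i = 0" for i
    using assms partial_hom_zero partial_hom_zero_right unfolding ppoly_def by metis
  then show ?thesis by (simp add: degree_def)
qed

lemma ppoly_zero: "ppoly \<Gamma> 0 g \<Longrightarrow> g = 0"
  unfolding ppoly_def by (intro poly_eqI) (auto dest: spec partial_hom_zero)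

text \<open>Long division run on \<open>f\<close> and on its image \<open>g\<close> at the same
  time. Since \<open>m\<close> is monic, each quotient term has the leading coefficient of the
  current remainder, and its counterpart has the image of that coefficient.\<close>

lemma ppoly_division:
  assumes m: "ppoly \<Gamma> m m'" "lead_coeff m = 1" and "ppoly \<Gamma> f g"
  shows "\<exists>q q' r r'. ppoly \<Gamma> q q' \<and> ppoly \<Gamma> r r' \<and> f = q * m + r \<and> g = q' * m' + r' \<and>
           (r = 0 \<or> degree r < degree m)"
  using assms(3)
proof (induction "degree f" arbitrary: f g rule: less_induct)
  case less
  show ?case
  proof (cases "f = 0 \<or> degree f < degree m")
    case True
    then show ?thesis
      using less.prems ppoly_Rats[of 0]
      by (intro exI[of _ "0 :: complex poly"] exI[of _ f] exI[of _ g]) auto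
  next
    case False
    define k where "k = degree f - degree m"
    define c where "c = lead_coeff f"
    define c' where "c' = coeff g (degree f)"
    define s where "s = monom c k"
    define s' where "s' = monom c' k"
    have s: "ppoly \<Gamma> s s'" unfolding s_def s'_def
      by (rule ppoly_monom) (use less.prems in \<open>auto simp: c_def c'_def ppoly_def\<close>)
    have f1: "ppoly \<Gamma> (f - s * m) (g - s' * m')"
      by (intro ppoly_diff ppoly_mult s m less.prems)
    \<comment> \<open>A zero difference is a separate case: if \<open>f\<close> is constant, the
      degree does not drop.\<close>
    have "f - s * m = 0 \<or> degree (f - s * m) < degree f"
    proof -
      have c0: "c \<noteq> 0" using False by (simp add: c_def)
      have "m \<noteq> 0" using m by auto
      then have ds: "degree (s * m) = degree f"
        using c0 False by (simp add: degree_mult_eq s_def degree_monom_eq k_def)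
      moreover have "lead_coeff (s * m) = lead_coeff f"
        unfolding lead_coeff_mult using m c0 by (simp add: s_def c_def degree_monom_eq)
      ultimately have "degree (f - s * m) \<le> degree f" "coeff (f - s * m) (degree f) = 0"
        by (auto intro: degree_diff_le)
      then show ?thesis
        by (metis leading_coeff_0_iff order_le_less)
    qed
    then have "\<exists>q q' r r'. ppoly \<Gamma> q q' \<and> ppoly \<Gamma> r r' \<and> f - s * m = q * m + r \<and>
        g - s' * m' = q' * m' + r' \<and> (r = 0 \<or> degree r < degree m)"
    proof
      assume 0: "f - s * m = 0"
      moreover have "g - s' * m' = 0" using f1 ppoly_zero unfolding 0 by blast
      ultimately show ?thesis using ppoly_Rats[of 0]
        by (intro exI[of _ "0 :: complex poly"]) auto
    next
      assume "degree (f - s * m) < degree f"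
      from less.hyps[OF this f1] show ?thesis .
    qed
    then obtain q q' r r' where qr: "ppoly \<Gamma> q q'" "ppoly \<Gamma> r r'" "f - s * m = q * m + r"
        "g - s' * m' = q' * m' + r'" "r = 0 \<or> degree r < degree m"
      by blast
    have "f = (q + s) * m + r" "g = (q' + s') * m' + r'"
      using qr(3,4) by (simp_all add: algebra_simps)
    then show ?thesis using qr ppoly_add[OF qr(1) s] by blast
  qed
qed

text \<open>\<open>m\<close> is the minimal polynomial of \<open>y\<close> over the field on which
  \<open>\<Gamma>\<close> is defined, and \<open>m'\<close> is its image.\<close>

definition minimal_ppoly :: "complex \<Rightarrow> complex poly \<Rightarrow> complex poly \<Rightarrow> bool" where
  "minimal_ppoly y m m' \<longleftrightarrow> ppoly \<Gamma> m m' \<and> lead_coeff m = 1 \<and> poly m y = 0 \<and>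
     (\<forall>f g. ppoly \<Gamma> f g \<longrightarrow> f \<noteq> 0 \<longrightarrow> poly f y = 0 \<longrightarrow> degree m \<le> degree f)"

lemma minimal_ppoly_exists:
  assumes "algebraic y"
  obtains m m' where "minimal_ppoly y m m'"
proof -
  obtain p :: "int poly" where p: "p \<noteq> 0" "poly (map_poly of_int p) y = 0"
    using algebraicE'[OF assms] by blast
  let ?R = "\<lambda>fg. ppoly \<Gamma> (fst fg) (snd fg) \<and> fst fg \<noteq> 0 \<and> poly (fst fg) y = 0"
  have "?R (map_poly of_int p, map_poly of_int p)"
    using p by (auto simp: ppoly_Rats coeff_map_poly)
  then obtain fg where fg: "?R fg" "\<And>fg'. ?R fg' \<Longrightarrow> degree (fst fg) \<le> degree (fst fg')"
    using ex_has_least_nat[of ?R _ "\<lambda>fg. degree (fst fg)"] by blast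
  obtain f g where f: "fg = (f, g)" by (cases fg)
  define m where "m = monom (inverse (lead_coeff f)) 0 * f"
  define m' where "m' = monom (inverse (coeff g (degree f))) 0 * g"
  have f0: "lead_coeff f \<noteq> 0" using fg f by simp
  have "ppoly \<Gamma> m m'"
    unfolding m_def m'_def
    using fg f f0 by (intro ppoly_mult ppoly_monom partial_hom_inverse) (auto simp: ppoly_def)
  moreover have "lead_coeff m = 1" "poly m y = 0" "degree m = degree f"
    using f0 fg f by (auto simp: m_def monom_0)
  ultimately have "minimal_ppoly y m m'"
    using fg(2) f by (auto simp: minimal_ppoly_def)
  then show ?thesis using that by blast
qed

text \<open>The extension sends \<open>f(y)\<close> to \<open>g(z)\<close> whenever \<open>g\<close>
  is the image of \<open>f\<close>. It is well defined because \<open>f(y) = 0\<close> forces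
  \<open>g(z) = 0\<close>: the remainder of \<open>f\<close> modulo \<open>m\<close> vanishes by
  minimality, so in parallel \<open>m'\<close> divides \<open>g\<close>, and \<open>m'\<close>
  vanishes at \<open>z\<close>.\<close>

lemma partial_hom_extend:
  assumes y: "algebraic y" and m: "minimal_ppoly y m m'" and z: "poly m' z = 0"
  obtains \<Gamma>' where "partial_hom \<Gamma>'" "\<Gamma> \<subseteq> \<Gamma>'" "(y, z) \<in> \<Gamma>'"
proof
  define \<Gamma>' where "\<Gamma>' = {(poly f y, poly g z) | f g. ppoly \<Gamma> f g}"
  have in\<Gamma>': "(poly f y, poly g z) \<in> \<Gamma>'" if "ppoly \<Gamma> f g" for f g
    using that by (auto simp: \<Gamma>'_def)
  show sub: "\<Gamma> \<subseteq> \<Gamma>'"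
  proof
    fix uv assume "uv \<in> \<Gamma>"
    then show "uv \<in> \<Gamma>'"
      using in\<Gamma>'[OF ppoly_monom[of "fst uv" "snd uv" 0]] by (simp add: monom_0)
  qed
  show "(y, z) \<in> \<Gamma>'"
    using in\<Gamma>'[OF ppoly_monom[OF partial_hom_Rats[of 1], of 1]] by (simp add: poly_monom)
  have "v = 0" if v: "(0, v) \<in> \<Gamma>'" for v
  proof -
    obtain f g where "ppoly \<Gamma> f g" "(0, v) = (poly f y, poly g z)"
      using v unfolding \<Gamma>'_def by blast
    then have fg: "ppoly \<Gamma> f g" "poly f y = 0" "v = poly g z" by auto
    obtain q q' r r' where qr: "ppoly \<Gamma> r r'" "f = q * m + r" "g = q' * m' + r'"
        "r = 0 \<or> degree r < degree m"
      using ppoly_division[of m m' f g] m fg(1) by (auto simp: minimal_ppoly_def)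
    have "poly r y = 0" using qr(2) fg(2) m by (simp add: minimal_ppoly_def)
    then have "r = 0" using qr(1,4) m by (auto simp: minimal_ppoly_def not_le[symmetric])
    then have "r' = 0" using qr(1) ppoly_zero by blast
    then show ?thesis using qr(3) fg(3) z by simp
  qed
  moreover have "algebraic u" if uv: "(u, v) \<in> \<Gamma>'" for u v
  proof -
    obtain f g where fg: "ppoly \<Gamma> f g" "u = poly f y"
      using uv by (auto simp: \<Gamma>'_def)
    then show ?thesis unfolding fg(2) poly_altdef
      by (intro algebraic_sum algebraic_times algebraic_power y)
        (auto simp: ppoly_def intro: partial_hom_algebraic)
  qed
  moreover have "(u + u', v + v') \<in> \<Gamma>'" "(u * u', v * v') \<in> \<Gamma>'"
    if uv: "(u, v) \<in> \<Gamma>'" "(u', v') \<in> \<Gamma>'" for u v u' v'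
  proof -
    obtain f g f' g' where fg: "ppoly \<Gamma> f g" "ppoly \<Gamma> f' g'"
      and eqs: "u = poly f y" "v = poly g z" "u' = poly f' y" "v' = poly g' z"
      using uv by (auto simp: \<Gamma>'_def)
    show "(u + u', v + v') \<in> \<Gamma>'" using in\<Gamma>'[OF ppoly_add[OF fg]] eqs by simp
    show "(u * u', v * v') \<in> \<Gamma>'" using in\<Gamma>'[OF ppoly_mult[OF fg]] eqs by simp
  qed
  ultimately show "partial_hom \<Gamma>'"
    using sub partial_hom_Rats unfolding partial_hom_def by blast
qed

end

section \<open>Extending partial homomorphisms to automorphisms\<close>

lemma poly_root_exists_complex: "degree (f :: complex poly) > 0 \<Longrightarrow> \<exists>z. poly f z = 0"
  by (metis alg_closed_imp_poly_has_root)

lemma partial_hom_Union_chain: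
  assumes "C \<noteq> {}" "subset.chain {\<Gamma>. partial_hom \<Gamma>} C"
  shows "partial_hom (\<Union>C)"
proof -
  have C: "partial_hom \<Gamma>" if "\<Gamma> \<in> C" for \<Gamma>
    using assms(2) that by (auto simp: subset.chain_def)
  have common: "\<exists>\<Gamma>\<in>C. u \<in> \<Gamma> \<and> v \<in> \<Gamma>" if uv: "u \<in> \<Union>C" "v \<in> \<Union>C" for u v
  proof -
    obtain \<Gamma>1 \<Gamma>2 where "\<Gamma>1 \<in> C" "u \<in> \<Gamma>1" "\<Gamma>2 \<in> C" "v \<in> \<Gamma>2" using uv by blast
    moreover from this have "\<Gamma>1 \<subseteq> \<Gamma>2 \<or> \<Gamma>2 \<subseteq> \<Gamma>1"
      using assms(2) by (auto simp: subset_chain_def)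
    ultimately show ?thesis by blast
  qed
  obtain \<Gamma>0 where "\<Gamma>0 \<in> C" using assms(1) by blast
  show ?thesis
    unfolding partial_hom_def
  proof (intro conjI ballI allI impI)
    fix q :: complex assume "q \<in> \<rat>"
    then show "(q, q) \<in> \<Union>C" using partial_hom_Rats[OF C] \<open>\<Gamma>0 \<in> C\<close> by blast
  next
    fix x y x' y' assume "(x, y) \<in> \<Union>C" "(x', y') \<in> \<Union>C"
    then obtain \<Gamma> where "\<Gamma> \<in> C" "(x, y) \<in> \<Gamma>" "(x', y') \<in> \<Gamma>" using common by blast
    then show "(x + x', y + y') \<in> \<Union>C" "(x * x', y * y') \<in> \<Union>C"
      using partial_hom_add[OF C] partial_hom_mult[OF C] by blast+
  next
    fix x y assume "(x, y) \<in> \<Union>C"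
    then show "algebraic x" using partial_hom_algebraic[OF C] by blast
  next
    fix y assume "(0, y) \<in> \<Union>C"
    then show "y = 0" using partial_hom_zero[OF C] by blast
  qed
qed

text \<open>Zorn's lemma yields a maximal extension. It is defined at every algebraic
  \<open>y\<close>, because the image of the minimal polynomial of \<open>y\<close> has a complex
  root to which \<open>y\<close> could be sent.\<close>

lemma partial_hom_extend_total:
  assumes "partial_hom \<Gamma>0"
  obtains \<Gamma> where "partial_hom \<Gamma>" "\<Gamma>0 \<subseteq> \<Gamma>" "\<And>y. algebraic y \<Longrightarrow> \<exists>z. (y, z) \<in> \<Gamma>"
proof -
  let ?A = "{\<Gamma>. partial_hom \<Gamma> \<and> \<Gamma>0 \<subseteq> \<Gamma>}"
  have "\<exists>M\<in>?A. \<forall>X\<in>?A. M \<subseteq> X \<longrightarrow> X = M"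
  proof (rule subset_Zorn_nonempty)
    show "?A \<noteq> {}" using assms by blast
    fix C assume C: "C \<noteq> {}" "subset.chain ?A C"
    then have "subset.chain {\<Gamma>. partial_hom \<Gamma>} C" by (auto simp: subset_chain_def)
    moreover have "\<Gamma>0 \<subseteq> \<Union>C" using C unfolding subset_chain_def by blast
    ultimately show "\<Union>C \<in> ?A" using partial_hom_Union_chain[OF C(1)] by simp
  qed
  then obtain \<Gamma> where "\<Gamma> \<in> ?A" and max': "\<forall>X\<in>?A. \<Gamma> \<subseteq> X \<longrightarrow> X = \<Gamma>" ..
  then have \<Gamma>: "partial_hom \<Gamma>" "\<Gamma>0 \<subseteq> \<Gamma>" by simp_all
  have max: "X = \<Gamma>" if "partial_hom X" "\<Gamma> \<subseteq> X" for X
  proof -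
    have "X \<in> ?A" using that(1) order_trans[OF \<Gamma>(2) that(2)] by simp
    from bspec[OF max' this] show ?thesis using that(2) by simp
  qed
  have "\<exists>z. (y, z) \<in> \<Gamma>" if y: "algebraic y" for y
  proof -
    obtain m m' where m: "minimal_ppoly \<Gamma> y m m'"
      using minimal_ppoly_exists[OF \<Gamma>(1) y] by blast
    have "degree m > 0"
    proof (rule ccontr)
      assume "\<not> degree m > 0"
      then obtain k where "m = [:k:]" by (auto elim: degree_eq_zeroE)
      then show False using m by (auto simp: minimal_ppoly_def[OF \<Gamma>(1)])
    qed
    then have "degree m' > 0"
      using ppoly_degree[OF \<Gamma>(1), of m m'] m by (auto simp: minimal_ppoly_def[OF \<Gamma>(1)])
    then obtain z where "poly m' z = 0" using poly_root_exists_complex by blast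
    then show ?thesis using partial_hom_extend[OF \<Gamma>(1) y m] max by metis
  qed
  then show ?thesis using that \<Gamma> by blast
qed

text \<open>The automorphisms of the field of algebraic numbers, extended by the identity to all of
  the complex numbers so that they form a group under composition.\<close>

definition gal :: "(complex \<Rightarrow> complex) set" where
  "gal = {\<sigma>. bij \<sigma> \<and> (\<forall>x. algebraic (\<sigma> x) \<longleftrightarrow> algebraic x) \<and> (\<forall>x. \<not> algebraic x \<longrightarrow> \<sigma> x = x) \<and>
     (\<forall>q\<in>\<rat>. \<sigma> q = q) \<and>
     (\<forall>x y. algebraic x \<longrightarrow> algebraic y \<longrightarrow> \<sigma> (x + y) = \<sigma> x + \<sigma> y \<and> \<sigma> (x * y) = \<sigma> x * \<sigma> y)}"

lemma gal_from_total_partial_hom: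
  assumes \<Gamma>: "partial_hom \<Gamma>" and total: "\<And>y. algebraic y \<Longrightarrow> \<exists>z. (y, z) \<in> \<Gamma>"
  obtains \<sigma> where "\<sigma> \<in> gal" "\<And>x y. (x, y) \<in> \<Gamma> \<Longrightarrow> \<sigma> x = y"
proof -
  define \<sigma> where "\<sigma> x = (if algebraic x then (THE z. (x, z) \<in> \<Gamma>) else x)" for x
  have \<sigma>_eq: "\<sigma> x = y" if "(x, y) \<in> \<Gamma>" for x y
    using that partial_hom_algebraic[OF \<Gamma>] partial_hom_unique[OF \<Gamma>] unfolding \<sigma>_def by auto
  have \<sigma>: "(x, \<sigma> x) \<in> \<Gamma>" if "algebraic x" for x
    using total[OF that] \<sigma>_eq by blast
  have root: "poly (map_poly of_int p) (\<sigma> x) = 0"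
    if "algebraic x" "poly (map_poly of_int p) x = 0" for x p
    using partial_hom_int_root[OF \<Gamma> \<sigma>] that by blast
  have alg: "algebraic (\<sigma> x)" if x: "algebraic x" for x
  proof -
    obtain p :: "int poly" where p: "p \<noteq> 0" "poly (map_poly of_int p) x = 0"
      using algebraicE'[OF x] by blast
    show ?thesis
      by (rule algebraicI[of "map_poly of_int p"]) (use p root x in \<open>auto simp: coeff_map_poly\<close>)
  qed
  have inj: "x = y" if "algebraic x" "algebraic y" "\<sigma> x = \<sigma> y" for x y
    using partial_hom_diff[OF \<Gamma> \<sigma>[OF that(1)] \<sigma>[OF that(2)]] that(3)
      partial_hom_zero_right[OF \<Gamma>, of "x - y"] by simp
  \<comment> \<open>\<open>\<sigma>\<close> maps the finite root set of an integer polynomial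
    injectively into itself, hence onto itself.\<close>
  have surj: "\<exists>x. algebraic x \<and> \<sigma> x = y" if y: "algebraic y" for y
  proof -
    obtain p :: "int poly" where p: "p \<noteq> 0" "poly (map_poly of_int p) y = 0"
      using algebraicE'[OF y] by blast
    let ?R = "{x :: complex. poly (map_poly of_int p) x = 0}"
    have algR: "algebraic x" if "x \<in> ?R" for x
      by (rule algebraicI[of "map_poly of_int p"]) (use p that in \<open>auto simp: coeff_map_poly\<close>)
    have "finite ?R" using p by (intro poly_roots_finite) auto
    moreover have "\<sigma> ` ?R \<subseteq> ?R" using root algR by auto
    moreover have "inj_on \<sigma> ?R" using inj algR by (auto intro!: inj_onI)
    ultimately have "\<sigma> ` ?R = ?R" by (rule endo_inj_surj)
    then show ?thesis using p algR by (metis (mono_tags, lifting) image_iff mem_Collect_eq)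
  qed
  have nalg: "\<sigma> x = x" if "\<not> algebraic x" for x using that by (simp add: \<sigma>_def)
  have "bij \<sigma>"
  proof (rule bijI)
    show "inj \<sigma>" by (rule injI) (metis inj alg nalg)
    show "surj \<sigma>" unfolding surj_def by (metis surj nalg)
  qed
  moreover have "algebraic (\<sigma> x) \<longleftrightarrow> algebraic x" for x
    using alg nalg by (cases "algebraic x") auto
  ultimately have "\<sigma> \<in> gal"
    unfolding gal_def
    using nalg \<sigma>_eq partial_hom_Rats[OF \<Gamma>] partial_hom_add[OF \<Gamma> \<sigma> \<sigma>] partial_hom_mult[OF \<Gamma> \<sigma> \<sigma>]
    by auto
  then show ?thesis using that \<sigma>_eq by blast
qed

text \<open>The minimal polynomial of \<open>x\<close> over the rationals has degree at least 2 and
  a root \<open>z\<close> different from \<open>x\<close>. The identity on the rationals extends to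
  an automorphism sending \<open>x\<close> to \<open>z\<close>.\<close>

lemma gal_moves_irrational:
  assumes x: "algebraic x" "x \<notin> \<rat>"
  obtains \<sigma> where "\<sigma> \<in> gal" "\<sigma> x \<noteq> x"
proof -
  define \<Gamma> where "\<Gamma> = {(q :: complex, q) | q. q \<in> \<rat>}"
  have \<Gamma>: "partial_hom \<Gamma>"
    unfolding partial_hom_def \<Gamma>_def by (auto intro: rat_imp_algebraic)
  have ppoly_iff: "ppoly \<Gamma> f g \<longleftrightarrow> f = g \<and> (\<forall>i. coeff f i \<in> \<rat>)" for f g
    by (auto simp: ppoly_def \<Gamma>_def poly_eq_iff)
  obtain m where m: "minimal_ppoly \<Gamma> x m m"
    using minimal_ppoly_exists[OF \<Gamma> x(1)] by (metis minimal_ppoly_def[OF \<Gamma>] ppoly_iff)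
  then have rat: "coeff m i \<in> \<rat>" and monic: "lead_coeff m = 1" and root: "poly m x = 0"
    and min: "\<And>f. (\<And>i. coeff f i \<in> \<rat>) \<Longrightarrow> f \<noteq> 0 \<Longrightarrow> poly f x = 0 \<Longrightarrow> degree m \<le> degree f" for i
    unfolding minimal_ppoly_def[OF \<Gamma>] ppoly_iff by auto
  have m0: "m \<noteq> 0" using monic by auto
  obtain g where g: "m = [:- x, 1:] * g" using root by (auto simp: poly_eq_0_iff_dvd elim: dvdE)
  then have g0: "g \<noteq> 0" using m0 by auto
  have dm: "degree m = Suc (degree g)"
    unfolding g using g0 by (subst degree_mult_eq) auto
  have "degree g > 0"
  proof (rule ccontr)
    assume "\<not> degree g > 0"
    then obtain k where k: "g = [:k:]" by (auto elim: degree_eq_zeroE)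
    then have "m = [:- x * k, k:]" "k \<noteq> 0" using g g0 by (auto simp: mult.commute)
    then have "k = 1" using monic by simp
    then have "coeff m 0 = - x" using \<open>m = [:- x * k, k:]\<close> by simp
    then show False using rat[of 0] x(2) by simp
  qed
  then obtain z where z: "poly g z = 0" using poly_root_exists_complex by blast
  \<comment> \<open>A double root would also be a root of the derivative, a nonzero rational
    polynomial of smaller degree.\<close>
  have "z \<noteq> x"
  proof
    assume "z = x"
    then have "poly (pderiv m) x = 0"
      using z by (simp add: g pderiv_mult pderiv_pCons del: mult_pCons_left)
    moreover have "coeff (pderiv m) i \<in> \<rat>" for i
      using rat by (simp add: coeff_pderiv del: of_nat_Suc)
    moreover have "pderiv m \<noteq> 0" using dm by (simp add: pderiv_eq_0_iff)
    ultimately have "degree m \<le> degree (pderiv m)" using min by blast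
    then show False using dm by (simp add: degree_pderiv)
  qed
  moreover have "poly m z = 0" using z by (simp add: g del: mult_pCons_left)
  ultimately obtain \<Gamma>1 where \<Gamma>1: "partial_hom \<Gamma>1" "(x, z) \<in> \<Gamma>1"
    using partial_hom_extend[OF \<Gamma> x(1) m] by blast
  obtain \<Gamma>2 where \<Gamma>2: "partial_hom \<Gamma>2" "\<Gamma>1 \<subseteq> \<Gamma>2" "\<And>y. algebraic y \<Longrightarrow> \<exists>z. (y, z) \<in> \<Gamma>2"
    using partial_hom_extend_total[OF \<Gamma>1(1)] by blast
  obtain \<sigma> where "\<sigma> \<in> gal" "\<And>x y. (x, y) \<in> \<Gamma>2 \<Longrightarrow> \<sigma> x = y"
    using gal_from_total_partial_hom[OF \<Gamma>2(1,3)] by blast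
  then show ?thesis using that \<Gamma>1 \<Gamma>2 \<open>z \<noteq> x\<close> by (metis subsetD)
qed

section \<open>Orbits under normal subgroups of finite index\<close>

lemma gal_bij: "\<sigma> \<in> gal \<Longrightarrow> bij \<sigma>"
  and gal_algebraic_iff: "\<sigma> \<in> gal \<Longrightarrow> algebraic (\<sigma> x) \<longleftrightarrow> algebraic x"
  and gal_nonalgebraic: "\<sigma> \<in> gal \<Longrightarrow> \<not> algebraic x \<Longrightarrow> \<sigma> x = x"
  and gal_Rats: "\<sigma> \<in> gal \<Longrightarrow> q \<in> \<rat> \<Longrightarrow> \<sigma> q = q"
  and gal_add: "\<sigma> \<in> gal \<Longrightarrow> algebraic x \<Longrightarrow> algebraic y \<Longrightarrow> \<sigma> (x + y) = \<sigma> x + \<sigma> y"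
  and gal_mult: "\<sigma> \<in> gal \<Longrightarrow> algebraic x \<Longrightarrow> algebraic y \<Longrightarrow> \<sigma> (x * y) = \<sigma> x * \<sigma> y"
  by (simp_all add: gal_def)

lemma gal_inj: "\<sigma> \<in> gal \<Longrightarrow> \<sigma> x = \<sigma> y \<longleftrightarrow> x = y"
  using gal_bij by (metis bij_is_inj injD)

lemma id_in_gal: "id \<in> gal"
  by (simp add: gal_def)

lemma gal_comp: "\<sigma> \<in> gal \<Longrightarrow> \<tau> \<in> gal \<Longrightarrow> \<sigma> \<circ> \<tau> \<in> gal"
  by (auto simp: gal_def bij_comp)

text \<open>The name \<open>inv\<close> is taken by the group inverse of HOL-Algebra.\<close>

abbreviation ginv :: "(complex \<Rightarrow> complex) \<Rightarrow> complex \<Rightarrow> complex" where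
  "ginv \<equiv> inv_into UNIV"

lemma gal_inv_apply: "\<sigma> \<in> gal \<Longrightarrow> \<sigma> (ginv \<sigma> x) = x" "\<sigma> \<in> gal \<Longrightarrow> ginv \<sigma> (\<sigma> x) = x"
  by (simp_all add: gal_bij bij_is_surj bij_is_inj surj_f_inv_f)

lemma gal_inv:
  assumes \<sigma>: "\<sigma> \<in> gal" shows "ginv \<sigma> \<in> gal"
proof -
  have eqI: "ginv \<sigma> y = x" if "y = \<sigma> x" for x y using that gal_inv_apply(2)[OF \<sigma>] by simp
  have alg: "algebraic (ginv \<sigma> x) \<longleftrightarrow> algebraic x" for x
    using gal_algebraic_iff[OF \<sigma>, of "ginv \<sigma> x"] gal_inv_apply(1)[OF \<sigma>] by simp
  show ?thesis
    unfolding gal_def mem_Collect_eq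
  proof (intro conjI allI impI ballI alg)
    show "bij (ginv \<sigma>)" by (rule bij_imp_bij_inv[OF gal_bij[OF \<sigma>]])
    show "ginv \<sigma> x = x" if "\<not> algebraic x" for x
      by (rule eqI) (simp add: gal_nonalgebraic[OF \<sigma> that])
    show "ginv \<sigma> q = q" if "q \<in> \<rat>" for q
      by (rule eqI) (simp add: gal_Rats[OF \<sigma> that])
    show "ginv \<sigma> (x + y) = ginv \<sigma> x + ginv \<sigma> y" if "algebraic x" "algebraic y" for x y
      by (rule eqI) (simp add: gal_add[OF \<sigma>] alg that gal_inv_apply(1)[OF \<sigma>])
    show "ginv \<sigma> (x * y) = ginv \<sigma> x * ginv \<sigma> y" if "algebraic x" "algebraic y" for x y
      by (rule eqI) (simp add: gal_mult[OF \<sigma>] alg that gal_inv_apply(1)[OF \<sigma>])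
  qed
qed

lemma gal_minus: "\<sigma> \<in> gal \<Longrightarrow> algebraic x \<Longrightarrow> \<sigma> (- x) = - \<sigma> x"
  using gal_mult[of \<sigma> "- 1" x] gal_Rats[of \<sigma> "- 1"] by simp

lemma gal_prod:
  assumes "\<sigma> \<in> gal" "\<And>i. i \<in> I \<Longrightarrow> algebraic (f i)"
  shows "\<sigma> (prod f I) = (\<Prod>i\<in>I. \<sigma> (f i))"
  using assms(2)
  by (induction I rule: infinite_finite_induct)
    (auto simp: gal_Rats[OF assms(1)] gal_mult[OF assms(1)] algebraic_prod)

lemma gal_sum:
  assumes "\<sigma> \<in> gal" "\<And>i. i \<in> I \<Longrightarrow> algebraic (f i)"
  shows "\<sigma> (sum f I) = (\<Sum>i\<in>I. \<sigma> (f i))"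
  using assms(2)
  by (induction I rule: infinite_finite_induct)
    (auto simp: gal_Rats[OF assms(1)] gal_add[OF assms(1)] algebraic_sum)

lemma gal_power: "\<sigma> \<in> gal \<Longrightarrow> algebraic x \<Longrightarrow> \<sigma> (x ^ n) = \<sigma> x ^ n"
  by (induction n) (auto simp: gal_Rats gal_mult algebraic_power)

lemma gal_int_root:
  assumes \<sigma>: "\<sigma> \<in> gal" and x: "algebraic x" "poly (map_poly of_int p) x = 0"
  shows "poly (map_poly of_int p) (\<sigma> x) = 0"
proof -
  have alg: "algebraic (of_int (coeff p i) * x ^ i)" for i
    by (intro algebraic_times algebraic_power x(1)) auto
  have "poly (map_poly of_int p) (\<sigma> x) = (\<Sum>i\<le>degree p. of_int (coeff p i) * \<sigma> x ^ i)"
    by (simp add: poly_altdef coeff_map_poly degree_map_poly)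
  also have "\<dots> = (\<Sum>i\<le>degree p. \<sigma> (of_int (coeff p i) * x ^ i))"
    using x(1) by (intro sum.cong refl)
      (auto simp: gal_mult[OF \<sigma>] gal_Rats[OF \<sigma>] gal_power[OF \<sigma>] algebraic_power)
  also have "\<dots> = \<sigma> (poly (map_poly of_int p) x)"
    using gal_sum[OF \<sigma>, of "{..degree p}" "\<lambda>i. of_int (coeff p i) * x ^ i"] alg
    by (simp add: poly_altdef coeff_map_poly degree_map_poly)
  finally show ?thesis using x(2) gal_Rats[OF \<sigma>, of 0] by simp
qed

lemma gal_fixed_imp_Rats:
  "algebraic x \<Longrightarrow> (\<And>\<sigma>. \<sigma> \<in> gal \<Longrightarrow> \<sigma> x = x) \<Longrightarrow> x \<in> \<rat>"
  using gal_moves_irrational by blast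

section \<open>Orbits and blocks\<close>

definition orb :: "(complex \<Rightarrow> complex) set \<Rightarrow> complex \<Rightarrow> complex set" where
  "orb H a = (\<lambda>\<sigma>. \<sigma> a) ` H"

lemma orbI: "\<sigma> \<in> H \<Longrightarrow> \<sigma> a \<in> orb H a"
  by (simp add: orb_def)

lemma orbE: assumes "b \<in> orb H a" obtains \<sigma> where "\<sigma> \<in> H" "b = \<sigma> a"
  using assms by (auto simp: orb_def)

lemma finite_orb_gal:
  assumes "algebraic a" shows "finite (orb gal a)"
proof -
  obtain p :: "int poly" where p: "p \<noteq> 0" "poly (map_poly of_int p) a = 0"
    using algebraicE'[OF assms] by blast
  have "orb gal a \<subseteq> {x. poly (map_poly of_int p) x = 0}"
    using gal_int_root[OF _ assms p(2)] by (auto simp: orb_def)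
  moreover have "finite {x :: complex. poly (map_poly of_int p) x = 0}"
    using p by (intro poly_roots_finite) auto
  ultimately show ?thesis by (rule finite_subset)
qed

lemma orb_algebraic: "H \<subseteq> gal \<Longrightarrow> algebraic a \<Longrightarrow> b \<in> orb H a \<Longrightarrow> algebraic b"
  by (auto simp: orb_def gal_algebraic_iff subset_iff)

lemma gal_image_orb_gal: "\<sigma> \<in> gal \<Longrightarrow> b \<in> orb gal a \<Longrightarrow> \<sigma> b \<in> orb gal a"
  by (metis comp_apply gal_comp orbE orbI)

lemma orb_self: "id \<in> H \<Longrightarrow> a \<in> orb H a"
  using orbI[of id H a] by simp

text \<open>\<open>F\<close> is a finite set meeting every left coset of \<open>H\<close> in
  \<open>gal\<close>, so its cardinality bounds the index of \<open>H\<close>.\<close>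

locale finite_index_normal =
  fixes H F :: "(complex \<Rightarrow> complex) set"
  assumes H_gal: "H \<subseteq> gal" and id_H: "id \<in> H"
    and comp_H: "\<sigma> \<in> H \<Longrightarrow> \<tau> \<in> H \<Longrightarrow> \<sigma> \<circ> \<tau> \<in> H"
    and inv_H: "\<sigma> \<in> H \<Longrightarrow> ginv \<sigma> \<in> H"
    and normal_H: "\<sigma> \<in> gal \<Longrightarrow> h \<in> H \<Longrightarrow> \<sigma> \<circ> h \<circ> ginv \<sigma> \<in> H"
    and finite_F: "finite F" and F_gal: "F \<subseteq> gal"
    and cosets: "\<sigma> \<in> gal \<Longrightarrow> \<exists>\<tau>\<in>F. \<exists>h\<in>H. \<sigma> = \<tau> \<circ> h"
begin

lemma H_in_gal: "h \<in> H \<Longrightarrow> h \<in> gal" using H_gal by blast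

lemma orb_H_subset: "orb H a \<subseteq> orb gal a" using H_gal by (auto simp: orb_def)

lemma finite_orb: "algebraic a \<Longrightarrow> finite (orb H a)"
  using finite_orb_gal orb_H_subset finite_subset by metis

lemma orb_apply_H: assumes "h \<in> H" shows "orb H (h a) = orb H a"
proof -
  have "orb H (h a) \<subseteq> orb H a" if "h \<in> H" for h a
    using comp_H[OF _ that] by (metis comp_apply orbE orbI subsetI)
  from this[OF assms, of a] this[OF inv_H[OF assms], of "h a"] show ?thesis
    by (simp add: gal_inv_apply H_in_gal assms)
qed

lemma orb_eq: "b \<in> orb H a \<Longrightarrow> orb H b = orb H a"
  by (auto simp: orb_def[of H a] orb_apply_H)

text \<open>By normality, moving \<open>\<sigma>\<close> past an element of \<open>H\<close> only
  replaces that element by its conjugate, which is again in \<open>H\<close>. The reverse inclusion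
  applies this to \<open>ginv \<sigma>\<close>.\<close>

lemma image_orb: assumes "\<sigma> \<in> gal" shows "\<sigma> ` orb H b = orb H (\<sigma> b)"
proof -
  have sub: "\<sigma> ` orb H b \<subseteq> orb H (\<sigma> b)" if \<sigma>: "\<sigma> \<in> gal" for \<sigma> b
  proof
    fix x assume "x \<in> \<sigma> ` orb H b"
    then obtain h where h: "h \<in> H" "x = \<sigma> (h b)" by (auto simp: orb_def)
    then have "x = (\<sigma> \<circ> h \<circ> ginv \<sigma>) (\<sigma> b)" by (simp add: gal_inv_apply \<sigma>)
    then show "x \<in> orb H (\<sigma> b)" using normal_H[OF \<sigma> h(1)] unfolding orb_def by blast
  qed
  have "orb H (\<sigma> b) = \<sigma> ` ginv \<sigma> ` orb H (\<sigma> b)"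
    by (simp add: image_image gal_inv_apply assms)
  also have "\<dots> \<subseteq> \<sigma> ` orb H (ginv \<sigma> (\<sigma> b))"
    by (intro image_mono sub gal_inv assms)
  finally show ?thesis using sub[OF assms, of b] by (simp add: gal_inv_apply assms)
qed

definition blocks :: "complex \<Rightarrow> complex set set" where
  "blocks a = orb H ` orb gal a"

text \<open>The block of \<open>\<sigma> a\<close> depends only on the coset of
  \<open>\<sigma>\<close>. This bounds the number of blocks by \<open>card F\<close>, whatever
  \<open>a\<close> is.\<close>

lemma blocks_eq: "blocks a = (\<lambda>\<tau>. orb H (\<tau> a)) ` F"
proof
  show "(\<lambda>\<tau>. orb H (\<tau> a)) ` F \<subseteq> blocks a"
    using F_gal by (auto simp: blocks_def orb_def[of gal])
  show "blocks a \<subseteq> (\<lambda>\<tau>. orb H (\<tau> a)) ` F"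
  proof
    fix B assume "B \<in> blocks a"
    then obtain \<sigma> where \<sigma>: "\<sigma> \<in> gal" "B = orb H (\<sigma> a)" by (auto simp: blocks_def orb_def[of gal])
    obtain \<tau> h where \<tau>: "\<tau> \<in> F" "h \<in> H" "\<sigma> = \<tau> \<circ> h" using cosets[OF \<sigma>(1)] by blast
    then have "B = orb H (\<tau> a)"
      using F_gal \<sigma>(2) image_orb[of \<tau> "h a"] image_orb[of \<tau> a] orb_apply_H[of h a] by auto
    then show "B \<in> (\<lambda>\<tau>. orb H (\<tau> a)) ` F" using \<tau> by blast
  qed
qed

lemma finite_blocks: "finite (blocks a)"
  by (simp add: blocks_eq finite_F)

lemma card_blocks: "card (blocks a) \<le> card F"
  by (simp add: blocks_eq card_image_le finite_F)

lemma block_image: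
  assumes "B \<in> blocks a" obtains \<sigma> where "\<sigma> \<in> gal" "B = \<sigma> ` orb H a"
  using assms by (auto simp: blocks_def orb_def[of gal] image_orb)

lemma orb_in_blocks: "orb H a \<in> blocks a"
  using orb_self[OF id_in_gal] by (auto simp: blocks_def)

lemma Union_blocks: "\<Union>(blocks a) = orb gal a"
proof
  show "\<Union>(blocks a) \<subseteq> orb gal a"
  proof
    fix x assume "x \<in> \<Union>(blocks a)"
    then obtain b where b: "b \<in> orb gal a" "x \<in> orb H b" by (auto simp: blocks_def)
    then obtain h where "h \<in> H" "x = h b" by (auto simp: orb_def)
    then show "x \<in> orb gal a" using gal_image_orb_gal H_in_gal b(1) by blast
  qed
  show "orb gal a \<subseteq> \<Union>(blocks a)"
    using orb_self[OF id_H] by (auto simp: blocks_def)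
qed

lemma blocks_disjoint:
  assumes "B \<in> blocks a" "C \<in> blocks a" "B \<noteq> C" shows "B \<inter> C = {}"
proof (rule ccontr)
  assume "B \<inter> C \<noteq> {}"
  then obtain x where "x \<in> B" "x \<in> C" by blast
  then have "B = orb H x" "C = orb H x" using assms orb_eq by (auto simp: blocks_def)
  then show False using assms by simp
qed

lemma finite_block: "algebraic a \<Longrightarrow> B \<in> blocks a \<Longrightarrow> finite B"
  by (metis finite_orb_gal finite_subset Union_upper Union_blocks)

lemma block_algebraic: "algebraic a \<Longrightarrow> B \<in> blocks a \<Longrightarrow> b \<in> B \<Longrightarrow> algebraic b"
  by (metis Union_blocks UnionI orb_algebraic order_refl)

lemma prod_blocks:
  assumes "algebraic a"
  shows "(\<Prod>B\<in>blocks a. \<Prod>b\<in>B. f b) = (\<Prod>b\<in>orb gal a. f b)"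
proof -
  have "prod f (\<Union>(blocks a)) = (\<Prod>B\<in>blocks a. prod f B)"
    using prod.Union_disjoint[of "blocks a" f] blocks_disjoint finite_block[OF assms] by force
  then show ?thesis by (simp add: Union_blocks)
qed

lemma bij_betw_blocks:
  assumes "\<sigma> \<in> gal" shows "bij_betw ((`) \<sigma>) (blocks a) (blocks a)"
proof -
  have "(`) \<sigma> ` blocks a \<subseteq> blocks a"
  proof
    fix C assume "C \<in> (`) \<sigma> ` blocks a"
    then obtain b where "b \<in> orb gal a" "C = \<sigma> ` orb H b" by (auto simp: blocks_def)
    then show "C \<in> blocks a"
      using image_orb[OF assms] gal_image_orb_gal[OF assms] by (simp add: blocks_def)
  qed
  moreover have "inj_on ((`) \<sigma>) (blocks a)"
    by (rule inj_onI) (simp add: inj_image_eq_iff[OF bij_is_inj[OF gal_bij[OF assms]]])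
  ultimately show ?thesis
    unfolding bij_betw_def using endo_inj_surj[OF finite_blocks] by blast
qed

text \<open>The product over the \<open>H\<close>-orbit is the relative norm of \<open>a\<close>;
  elements of \<open>H\<close> merely permute its factors.\<close>

lemma orb_prod_fixed:
  assumes "algebraic a" "h \<in> H" shows "h (\<Prod>(orb H a)) = \<Prod>(orb H a)"
proof -
  have "h (\<Prod>(orb H a)) = (\<Prod>b\<in>orb H a. h b)"
    using assms by (intro gal_prod) (auto intro: H_in_gal orb_algebraic[OF H_gal])
  also have "\<dots> = prod (\<lambda>b. b) (h ` orb H a)"
    using gal_inj[OF H_in_gal[OF assms(2)]] by (subst prod.reindex) (auto intro!: inj_onI)
  also have "h ` orb H a = orb H a"
    using image_orb[OF H_in_gal[OF assms(2)], of a] orb_apply_H[OF assms(2)] by simp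
  finally show ?thesis .
qed

lemma tuple_norm:
  assumes \<alpha>: "\<And>h. h \<in> H \<Longrightarrow> h \<alpha> = \<alpha>"
    and as: "\<And>a. a \<in> set as \<Longrightarrow> algebraic a" "prod_list as = \<alpha>"
    and \<beta>: "\<And>a. a \<in> set as \<Longrightarrow> \<beta> a ^ card (orb H a) = \<Prod>(orb H a)"
  obtains m where "m > 0" "prod_list (map \<beta> as) ^ m = \<alpha> ^ m"
proof -
  \<comment> \<open>Multiply the conjugate factorizations over the \<open>H\<close>-orbit of the tuple \<open>as\<close>; the fibres over
    the conjugates of one entry all have the same size.\<close>
  define L where "L = (\<lambda>h. map h as) ` H"
  define m where "m = card L"
  \<comment> \<open>\<open>H\<close> itself may be infinite, but each entry has a finite orbit, so
    the tuple has only finitely many images.\<close>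
  have "L \<subseteq> {xs. set xs \<subseteq> (\<Union>a\<in>set as. orb H a) \<and> length xs = length as}"
    using orbI by (fastforce simp: L_def)
  moreover have "finite (\<Union>a\<in>set as. orb H a)" using as finite_orb by auto
  ultimately have finL: "finite L" using finite_lists_length_eq finite_subset by metis
  have m: "m > 0" using finL id_H by (auto simp: m_def L_def card_gt_0_iff)
  have prod_L: "prod_list x = \<alpha>" if "x \<in> L" for x
  proof -
    obtain h where h: "h \<in> H" "x = map h as" using \<open>x \<in> L\<close> by (auto simp: L_def)
    have "prod_list (map h bs) = h (prod_list bs) \<and> algebraic (prod_list bs)"
      if "\<And>b. b \<in> set bs \<Longrightarrow> algebraic b" for bs
      using that H_in_gal[OF h(1)]
      by (induction bs) (auto simp: gal_Rats gal_mult algebraic_times)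
    then show ?thesis using as \<alpha>[OF h(1)] h(2) by simp
  qed
  have len: "length x = length as" if "x \<in> L" for x using that by (auto simp: L_def)
  have fibre: "(\<Prod>x\<in>L. x ! i) = \<beta> (as ! i) ^ m" if i: "i < length as" for i
  proof -
    let ?a = "as ! i"
    define fib where "fib b = {x \<in> L. x ! i = b}" for b
    have a: "algebraic ?a" "?a \<in> set as" using as i by auto
    have fin_fib: "finite (fib b)" for b using finL by (simp add: fib_def)
    \<comment> \<open>Applying \<open>h\<close> entrywise maps the fibre over \<open>b\<close>
      injectively into the fibre over \<open>h b\<close>. Together with the same fact for
      \<open>ginv h\<close>, this makes all fibres over one orbit equally large.\<close>
    have le: "card (fib b) \<le> card (fib (h b))" if h: "h \<in> H" for h b
    proof (rule card_inj_on_le[of "map h"])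
      show "inj_on (map h) (fib b)"
        using gal_inj[OF H_in_gal[OF h]] by (auto intro!: inj_onI simp: inj_map_eq_map inj_def)
      show "map h ` fib b \<subseteq> fib (h b)"
      proof
        fix y assume "y \<in> map h ` fib b"
        then obtain g where g: "g \<in> H" "y = map (h \<circ> g) as" "map g as ! i = b"
          by (auto simp: fib_def L_def)
        then show "y \<in> fib (h b)" using comp_H[OF h g(1)] i by (auto simp: fib_def L_def)
      qed
    qed (rule fin_fib)
    have card_fib: "card (fib b) = card (fib ?a)" if b: "b \<in> orb H ?a" for b
    proof -
      obtain h where h: "h \<in> H" "b = h ?a" using b by (auto simp: orb_def)
      then show ?thesis
        using le[OF h(1), of ?a] le[OF inv_H[OF h(1)], of b]
        by (simp add: gal_inv_apply H_in_gal)
    qed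
    have maps: "(\<lambda>x. x ! i) ` L \<subseteq> orb H ?a" using i by (auto simp: L_def orb_def)
    have "m = (\<Sum>b\<in>orb H ?a. card (fib b))"
      unfolding m_def fib_def
      using sum.group[OF finL finite_orb[OF a(1)] maps, of "\<lambda>_. 1 :: nat"] by simp
    then have m_eq: "m = card (orb H ?a) * card (fib ?a)" using card_fib by simp
    have "(\<Prod>x\<in>L. x ! i) = (\<Prod>b\<in>orb H ?a. \<Prod>x\<in>fib b. x ! i)"
      unfolding fib_def by (rule prod.group[OF finL finite_orb[OF a(1)] maps, symmetric])
    also have "\<dots> = (\<Prod>b\<in>orb H ?a. b ^ card (fib ?a))"
    proof (rule prod.cong[OF refl])
      fix b assume b: "b \<in> orb H ?a"
      have "(\<Prod>x\<in>fib b. x ! i) = (\<Prod>x\<in>fib b. b)"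
        by (rule prod.cong) (auto simp: fib_def)
      then show "(\<Prod>x\<in>fib b. x ! i) = b ^ card (fib ?a)" using card_fib[OF b] by simp
    qed
    also have "\<dots> = (\<Prod>(orb H ?a)) ^ card (fib ?a)"
      by (simp add: prod_power_distrib)
    also have "\<dots> = \<beta> ?a ^ m"
      using \<beta>[OF a(2)] by (simp add: m_eq power_mult)
    finally show ?thesis .
  qed
  have "\<alpha> ^ m = (\<Prod>x\<in>L. prod_list x)" using prod_L by (simp add: m_def)
  also have "\<dots> = (\<Prod>x\<in>L. \<Prod>i<length as. x ! i)"
    by (rule prod.cong) (auto simp: prod.list_conv_set_nth len lessThan_atLeast0)
  also have "\<dots> = (\<Prod>i<length as. \<Prod>x\<in>L. x ! i)" by (rule prod.swap)
  also have "\<dots> = (\<Prod>i<length as. \<beta> (as ! i) ^ m)" by (rule prod.cong) (auto simp: fibre)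
  also have "\<dots> = prod_list (map \<beta> as) ^ m"
    by (simp add: prod.list_conv_set_nth lessThan_atLeast0 prod_power_distrib)
  finally show ?thesis using that m by simp
qed

end

section \<open>Pointwise stabilizers of finite invariant sets\<close>

definition galfix :: "complex set \<Rightarrow> (complex \<Rightarrow> complex) set" where
  "galfix R = {\<sigma> \<in> gal. \<forall>b\<in>R. \<sigma> b = b}"

text \<open>Automorphisms that agree on \<open>R\<close> lie in the same coset, and only finitely
  many restrictions occur because \<open>R\<close> is finite and invariant. Invariance also gives
  normality. \<open>F\<close> picks one automorphism for each restriction.\<close>

lemma finite_index_normal_galfix:
  assumes R: "finite R" "\<And>\<sigma> b. \<sigma> \<in> gal \<Longrightarrow> b \<in> R \<Longrightarrow> \<sigma> b \<in> R"
  obtains F where "finite_index_normal (galfix R) F"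
proof -
  let ?H = "galfix R" and ?r = "\<lambda>\<sigma>. restrict \<sigma> R"
  have fin: "finite (?r ` gal)"
    using R by (intro finite_subset[OF _ finite_PiE[of R "\<lambda>_. R"]]) auto
  define F where "F = (\<lambda>f. SOME \<sigma>. \<sigma> \<in> gal \<and> ?r \<sigma> = f) ` (?r ` gal)"
  have pick: "(SOME \<tau>. \<tau> \<in> gal \<and> ?r \<tau> = ?r \<sigma>) \<in> gal \<and> ?r (SOME \<tau>. \<tau> \<in> gal \<and> ?r \<tau> = ?r \<sigma>) = ?r \<sigma>"
    if "\<sigma> \<in> gal" for \<sigma>
    by (rule someI[of "\<lambda>\<tau>. \<tau> \<in> gal \<and> ?r \<tau> = ?r \<sigma>" \<sigma>]) (use that in auto)
  have inv_fix: "ginv \<sigma> b = b" if "\<sigma> \<in> gal" "\<sigma> b = b" for \<sigma> b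
    using gal_inv_apply(2)[OF that(1), of b] that(2) by simp
  have "finite_index_normal ?H F"
  proof
    show "?H \<subseteq> gal" "id \<in> ?H" by (auto simp: galfix_def id_in_gal)
    show "\<sigma> \<circ> \<tau> \<in> ?H" if "\<sigma> \<in> ?H" "\<tau> \<in> ?H" for \<sigma> \<tau>
      using that by (auto simp: galfix_def gal_comp)
    show "ginv \<sigma> \<in> ?H" if "\<sigma> \<in> ?H" for \<sigma>
      using that by (auto simp: galfix_def gal_inv inv_fix)
    show "\<sigma> \<circ> h \<circ> ginv \<sigma> \<in> ?H" if "\<sigma> \<in> gal" "h \<in> ?H" for \<sigma> h
      using that R(2)[OF gal_inv[OF that(1)]]
      by (auto simp: galfix_def gal_inv gal_comp gal_inv_apply)
    show "finite F" using fin by (simp add: F_def)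
    show "F \<subseteq> gal" using pick by (auto simp: F_def)
    show "\<exists>\<tau>\<in>F. \<exists>h\<in>?H. \<sigma> = \<tau> \<circ> h" if \<sigma>: "\<sigma> \<in> gal" for \<sigma>
    proof -
      define \<tau> where "\<tau> = (SOME \<tau>. \<tau> \<in> gal \<and> ?r \<tau> = ?r \<sigma>)"
      have \<tau>: "\<tau> \<in> F" "\<tau> \<in> gal" "?r \<tau> = ?r \<sigma>"
        using pick[OF \<sigma>] \<sigma> by (auto simp: F_def \<tau>_def)
      have "\<tau> b = \<sigma> b" if "b \<in> R" for b
        using fun_cong[OF \<tau>(3), of b] that by simp
      then have "ginv \<tau> \<circ> \<sigma> \<in> ?H"
        using \<tau>(2) \<sigma> gal_inv_apply(2)[OF \<tau>(2)]
        by (auto simp: galfix_def gal_comp gal_inv simp flip: \<open>\<And>b. b \<in> R \<Longrightarrow> \<tau> b = \<sigma> b\<close>)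
      moreover have "\<sigma> = \<tau> \<circ> (ginv \<tau> \<circ> \<sigma>)" by (simp add: fun_eq_iff gal_inv_apply \<tau>(2))
      ultimately show ?thesis using \<tau>(1) by blast
    qed
  qed
  then show ?thesis using that by blast
qed

section \<open>Mahler measure\<close>

text \<open>The Mahler measure before taking logarithms. Its value at the zero polynomial is 0,
  which makes it multiplicative without exception.\<close>

definition mahler :: "complex poly \<Rightarrow> real" where
  "mahler f = cmod (lead_coeff f) * (\<Prod>\<beta>\<in>#proots f. max 1 (cmod \<beta>))"

lemma prod_mset_max_ge_1: "(\<Prod>\<beta>\<in>#A. max 1 (cmod \<beta>)) \<ge> 1"
proof (induction A)
  case (add x A)
  have "1 * 1 \<le> max 1 (cmod x) * (\<Prod>\<beta>\<in>#A. max 1 (cmod \<beta>))"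
    by (rule mult_mono) (use add in auto)
  then show ?case by simp
qed auto

lemma mahler_mult: "mahler (f * g) = mahler f * mahler g"
  by (cases "f = 0 \<or> g = 0") (auto simp: mahler_def lead_coeff_mult proots_mult norm_mult)

lemma mahler_prod: "finite I \<Longrightarrow> mahler (prod f I) = (\<Prod>i\<in>I. mahler (f i))"
  by (induction I rule: finite_induct) (auto simp: mahler_mult, simp add: mahler_def)

lemma mahler_smult: "mahler (Polynomial.smult c f) = cmod c * mahler f"
  by (cases "c = 0") (auto simp: mahler_def norm_mult)

lemma mahler_linear: "mahler [:- x, 1:] = max 1 (cmod x)"
  by (simp add: mahler_def)

lemma mahler_nonneg: "mahler f \<ge> 0"
  unfolding mahler_def using prod_mset_max_ge_1[of "proots f"] by simp

lemma mahler_int_ge_1: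
  assumes "(p :: int poly) \<noteq> 0" shows "mahler (map_poly of_int p) \<ge> 1"
proof -
  have "cmod (lead_coeff (map_poly of_int p)) = real_of_int \<bar>lead_coeff p\<bar>"
    by (simp add: degree_map_poly coeff_map_poly)
  moreover have "real_of_int \<bar>lead_coeff p\<bar> \<ge> 1"
    using assms by (simp add: int_one_le_iff_zero_less flip: of_int_abs)
  ultimately show ?thesis
    unfolding mahler_def using prod_mset_max_ge_1[of "proots (map_poly of_int p)"]
    by (metis mult_mono[of 1 _ 1] mult_1 norm_ge_zero zero_le_one)
qed

text \<open>The cofactor is a nonzero integer polynomial, so its Mahler measure is at least
  1.\<close>

lemma mahler_int_dvd:
  assumes "p dvd (q :: int poly)" "q \<noteq> 0"
  shows "mahler (map_poly of_int p) \<le> mahler (map_poly of_int q)"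
proof -
  obtain r where r: "q = p * r" using assms by blast
  then have "mahler (map_poly of_int q) = mahler (map_poly of_int p) * mahler (map_poly of_int r)"
    by (simp add: of_int_poly_mult mahler_mult)
  moreover have "mahler (map_poly of_int r) \<ge> 1" using mahler_int_ge_1 r assms(2) by auto
  ultimately show ?thesis
    using mult_left_mono[of 1 "mahler (map_poly of_int r)" "mahler (map_poly of_int p)"] mahler_nonneg
    by auto
qed

lemma max_1_power: "(r :: real) \<ge> 0 \<Longrightarrow> max 1 (r ^ n) = max 1 r ^ n"
  using power_le_one[of r n] one_le_power[of r n] by (cases "r \<le> 1") auto

lemma power_minus_const:
  assumes "d > 0"
  shows "degree (monom 1 d - [:\<delta> :: complex:]) = d" "lead_coeff (monom 1 d - [:\<delta>:]) = 1"
    "monom 1 d - [:\<delta>:] \<noteq> 0"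
proof -
  have "degree (monom (1 :: complex) d + [:- \<delta>:]) = degree (monom (1 :: complex) d)"
    by (rule degree_add_eq_left) (use assms in \<open>simp add: degree_monom_eq\<close>)
  moreover have "monom 1 d - [:\<delta>:] = monom 1 d + [:- \<delta>:]"
    by (rule poly_eqI) (simp add: coeff_pCons split: nat.splits)
  ultimately show deg: "degree (monom 1 d - [:\<delta>:]) = d"
    by (metis degree_monom_eq one_neq_zero)
  then show "monom 1 d - [:\<delta>:] \<noteq> 0" using assms by (metis degree_0 less_irrefl)
  show "lead_coeff (monom 1 d - [:\<delta>:]) = 1"
    unfolding deg using assms by (simp add: coeff_pCons split: nat.splits)
qed

text \<open>All \<open>d\<close> roots have the absolute value
  \<open>r = root d (cmod \<delta>)\<close>, and \<open>max 1 r ^ d = max 1 (r ^ d)\<close>. Hence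
  substituting \<open>x ^ d\<close> for \<open>x\<close> in a product of linear factors preserves
  its Mahler measure.\<close>

lemma mahler_power_minus_const:
  assumes d: "d > 0" shows "mahler (monom 1 d - [:\<delta>:]) = max 1 (cmod \<delta>)"
proof -
  let ?f = "monom 1 d - [:\<delta>:]"
  note f0 = power_minus_const(3)[OF d, of \<delta>]
  define r where "r = root d (cmod \<delta>)"
  have r: "r \<ge> 0" "r ^ d = cmod \<delta>" using d by (auto simp: r_def)
  have "cmod \<beta> = r" if "\<beta> \<in># proots ?f" for \<beta>
  proof -
    have "\<beta> ^ d = \<delta>" using that f0 by (simp add: poly_monom)
    then have "cmod \<beta> ^ d = r ^ d" using r by (simp flip: norm_power)
    then show ?thesis using r(1) d by (simp add: power_eq_iff_eq_base)
  qed
  then have "image_mset (\<lambda>\<beta>. max 1 (cmod \<beta>)) (proots ?f) = image_mset (\<lambda>\<beta>. max 1 r) (proots ?f)"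
    by (intro image_mset_cong) auto
  then have "mahler ?f = max 1 r ^ d"
    unfolding mahler_def using power_minus_const[OF d, of \<delta>] size_proots_complex[of ?f] by simp
  then show ?thesis using max_1_power[OF r(1), of d] r(2) by simp
qed

section \<open>Minimal polynomials and the measure of an algebraic number\<close>

lemma int_minpoly:
  assumes "algebraic a"
  shows lead_coeff_int_minpoly: "lead_coeff (int_minpoly a) > 0"
    and int_minpoly_root: "poly (map_poly of_int (int_minpoly a)) a = 0"
  using is_int_minpoly_int_minpoly[OF assms] by (auto simp: is_int_minpoly_def)

lemma int_minpoly_nonzero: "algebraic a \<Longrightarrow> int_minpoly a \<noteq> 0"
  using lead_coeff_int_minpoly by fastforce

lemma log_mahler_eq:
  assumes "algebraic a"
  shows "log_mahler a = ln (mahler (map_poly of_int (int_minpoly a)))"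
proof -
  have "(\<Sum>\<beta>\<in>#A. log_plus (cmod \<beta>)) = ln (\<Prod>\<beta>\<in>#A. max 1 (cmod \<beta>))" for A
  proof (induction A)
    case (add x A)
    have "0 \<notin> (\<lambda>\<beta>. max 1 (cmod \<beta>)) ` set_mset A" by (auto simp: max_def split: if_splits)
    with add show ?case by (simp add: log_plus_def ln_mult)
  qed auto
  moreover have "0 \<notin> (\<lambda>\<beta>. max 1 (cmod \<beta>)) ` X" for X by (auto simp: max_def split: if_splits)
  ultimately show ?thesis
    unfolding log_mahler_def mahler_def using int_minpoly_nonzero[OF assms]
    by (simp add: ln_mult degree_map_poly coeff_map_poly)
qed

lemma log_mahler_nonneg: "algebraic a \<Longrightarrow> log_mahler a \<ge> 0"
  using mahler_int_ge_1[OF int_minpoly_nonzero] by (simp add: log_mahler_eq)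

text \<open>Factoring \<open>q\<close> over the integers yields an irreducible factor that vanishes
  at \<open>a\<close>. After a change of sign its leading coefficient is positive, so by uniqueness
  it is the minimal polynomial.\<close>

lemma int_minpoly_dvd:
  assumes a: "algebraic a" and q: "poly (map_poly of_int q) a = 0"
  shows "int_minpoly a dvd q"
proof (cases "q = 0")
  case False
  have "q \<noteq> 0 \<longrightarrow> poly (map_poly of_int q) a = 0 \<longrightarrow>
      (\<exists>r. irreducible r \<and> r dvd q \<and> poly (map_poly of_int r) a = 0)"
  proof (induction q rule: prime_divisors_induct)
    case (unit x)
    then obtain c where "x = [:c:]" by (auto simp: is_unit_poly_iff)
    then show ?case by (auto simp: map_poly_pCons)
  next
    case (factor p x)
    then show ?case
      using prime_elem_imp_irreducible[OF prime_imp_prime_elem, of p]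
      by (auto simp: of_int_poly_mult intro: dvd_mult)
  qed auto
  then obtain r where r: "irreducible r" "r dvd q" "poly (map_poly of_int r) a = 0"
    using False q by blast
  define s where "s = Polynomial.smult (sgn (lead_coeff r)) r"
  have r0: "lead_coeff r \<noteq> 0" using r(1) by auto
  have s_cases: "s = r \<or> s = - r" using r0 by (auto simp: s_def sgn_if)
  have "irreducible (- r)"
    using r(1) irreducible_mult_unit_left[of "- 1" r] by simp
  then have "irreducible s" using s_cases r(1) by auto
  moreover have "lead_coeff s > 0" using r0 by (auto simp: s_def sgn_if)
  moreover have "poly (map_poly of_int s) a = 0" using r(3) by (simp add: s_def of_int_poly_smult)
  ultimately have "is_int_minpoly a s" by (simp add: is_int_minpoly_def)
  then have "int_minpoly a = s"
    using is_int_minpoly_ex1[OF a] is_int_minpoly_int_minpoly[OF a] by blast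
  then show ?thesis using s_cases r(2) by auto
qed auto

lemma log_mahler_le:
  assumes "algebraic a" "poly (map_poly of_int q) a = 0" "q \<noteq> 0"
  shows "log_mahler a \<le> ln (mahler (map_poly of_int q))"
proof -
  have "mahler (map_poly of_int (int_minpoly a)) \<le> mahler (map_poly of_int q)"
    using assms by (intro mahler_int_dvd int_minpoly_dvd)
  moreover have "mahler (map_poly of_int (int_minpoly a)) \<ge> 1"
    by (rule mahler_int_ge_1[OF int_minpoly_nonzero[OF assms(1)]])
  ultimately show ?thesis by (simp add: log_mahler_eq[OF assms(1)])
qed

text \<open>\<open>\<zeta>\<close> is a root of \<open>x ^ m - 1\<close>, whose Mahler measure is
  1.\<close>

lemma log_mahler_root_of_unity:
  assumes "\<zeta> ^ m = 1" "m > 0"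
  shows "algebraic \<zeta>" "log_mahler \<zeta> = 0"
proof -
  let ?q = "monom 1 m - [:1:] :: int poly"
  have q: "map_poly of_int ?q = (monom 1 m - [:1:] :: complex poly)"
    by (rule poly_eqI) (auto simp: coeff_map_poly coeff_pCons split: nat.splits)
  show alg: "algebraic \<zeta>" by (rule algebraic_if_power[OF _ assms(2)]) (simp add: assms(1))
  have "?q \<noteq> 0"
    using power_minus_const(3)[OF assms(2), of 1] unfolding q[symmetric] by (metis map_poly_0)
  moreover have "poly (map_poly of_int ?q) \<zeta> = 0" unfolding q by (simp add: poly_monom assms)
  ultimately have "log_mahler \<zeta> \<le> ln (mahler (map_poly of_int ?q))"
    using log_mahler_le[OF alg] by blast
  also have "\<dots> = 0" unfolding q using mahler_power_minus_const[OF assms(2), of 1] by simp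
  finally show "log_mahler \<zeta> = 0" using log_mahler_nonneg[OF alg] by simp
qed

text \<open>The polynomial is built up from linear factors: multiplying by
  \<open>x - \<beta>\<close> enlarges the coefficient bound by at most the factor
  \<open>cmod \<beta> + 1\<close>, which does not exceed
  \<open>2 * max 1 (cmod \<beta>)\<close>.\<close>

lemma norm_coeff_le_mahler: "cmod (coeff f i) \<le> 2 ^ degree f * mahler f"
proof -
  have "cmod (coeff (\<Prod>x\<in>#A. [:- x, 1:]) i) \<le> 2 ^ size A * (\<Prod>\<beta>\<in>#A. max 1 (cmod \<beta>))" for A i
  proof (induction A arbitrary: i)
    case empty
    then show ?case by (simp add: coeff_1)
  next
    case (add x A)
    let ?Q = "\<Prod>x\<in>#A. [:- x, 1:]" and ?K = "2 ^ size A * (\<Prod>\<beta>\<in>#A. max 1 (cmod \<beta>))"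
    have K: "?K \<ge> 0" using prod_mset_max_ge_1[of A] by simp
    have "cmod (coeff ([:- x, 1:] * ?Q) i) \<le> cmod x * cmod (coeff ?Q i) + (case i of 0 \<Rightarrow> 0 | Suc j \<Rightarrow> cmod (coeff ?Q j))"
      using norm_triangle_ineq[of "- (x * coeff ?Q i)" "case i of 0 \<Rightarrow> 0 | Suc j \<Rightarrow> coeff ?Q j"]
      by (auto simp: coeff_pCons norm_mult split: nat.splits)
    also have "\<dots> \<le> cmod x * ?K + ?K"
      using add K by (intro add_mono mult_left_mono) (auto split: nat.splits)
    also have "\<dots> = (cmod x + 1) * ?K" by (simp add: algebra_simps)
    also have "\<dots> \<le> (2 * max 1 (cmod x)) * ?K"
      using K by (intro mult_right_mono) auto
    finally show ?case by (simp add: mult_ac)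
  qed
  from this[of "proots f" i]
  have "cmod (lead_coeff f) * cmod (coeff (\<Prod>x\<in>#proots f. [:- x, 1:]) i)
      \<le> cmod (lead_coeff f) * (2 ^ size (proots f) * (\<Prod>\<beta>\<in>#proots f. max 1 (cmod \<beta>)))"
    by (intro mult_left_mono) auto
  also have "cmod (lead_coeff f) * cmod (coeff (\<Prod>x\<in>#proots f. [:- x, 1:]) i) = cmod (coeff f i)"
    by (subst (3) complex_poly_decompose_multiset[symmetric]) (simp add: norm_mult)
  finally show ?thesis by (simp add: mahler_def size_proots_complex mult_ac)
qed

text \<open>Northcott's argument: bounds on degree and measure bound the integer coefficients, which
  leaves finitely many coefficient lists.\<close>

lemma finite_mahler_bounded: "finite {p :: int poly. degree p \<le> D \<and> mahler (map_poly of_int p) \<le> B}"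
proof -
  define N where "N = \<lceil>2 ^ D * B\<rceil>"
  have "{p :: int poly. degree p \<le> D \<and> mahler (map_poly of_int p) \<le> B}
      \<subseteq> Poly ` {xs. set xs \<subseteq> {- N..N} \<and> length xs \<le> Suc D}" (is "?L \<subseteq> ?R")
  proof
    fix p assume p: "p \<in> ?L"
    have "set (coeffs p) \<subseteq> {- N..N}"
    proof
      fix c assume "c \<in> set (coeffs p)"
      then obtain i where i: "c = coeff p i" by (auto simp: coeffs_def split: if_splits)
      have "real_of_int \<bar>c\<bar> = cmod (coeff (map_poly of_int p) i)"
        by (simp add: i coeff_map_poly)
      also have "\<dots> \<le> 2 ^ degree p * mahler (map_poly of_int p)"
        using norm_coeff_le_mahler[of "map_poly of_int p" i] by (simp add: degree_map_poly)
      also have "\<dots> \<le> 2 ^ D * B"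
        using p mahler_nonneg[of "map_poly of_int p"] by (intro mult_mono) auto
      finally have "\<bar>c\<bar> \<le> N" unfolding N_def by linarith
      then show "c \<in> {- N..N}" by auto
    qed
    moreover have "length (coeffs p) \<le> Suc D" using p by (simp add: length_coeffs_degree coeffs_def)
    ultimately have "Poly (coeffs p) \<in> ?R" by blast
    then show "p \<in> ?R" by simp
  qed
  moreover have "finite {xs :: int list. set xs \<subseteq> {- N..N} \<and> length xs \<le> Suc D}"
    by (rule finite_lists_length_le) auto
  ultimately show ?thesis by (meson finite_imageI finite_subset)
qed

text \<open>The values needed later come from block polynomials and not from minimal polynomials,
  hence the range over all nonzero polynomials of bounded degree.\<close>

definition mahler_values :: "nat \<Rightarrow> real set" where
  "mahler_values D = {ln (mahler (map_poly of_int p)) | p :: int poly. p \<noteq> 0 \<and> degree p \<le> D}"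

lemma finite_mahler_values: "finite (mahler_values D \<inter> {..B})"
proof (rule finite_subset)
  show "mahler_values D \<inter> {..B} \<subseteq> (\<lambda>p. ln (mahler (map_poly of_int p))) `
      {p. degree p \<le> D \<and> mahler (map_poly of_int p) \<le> exp B}" (is "_ \<subseteq> ?R")
  proof
    fix x assume "x \<in> mahler_values D \<inter> {..B}"
    then obtain p :: "int poly"
      where p: "x = ln (mahler (map_poly of_int p))" "p \<noteq> 0" "degree p \<le> D" "x \<le> B"
      by (auto simp: mahler_values_def)
    have "mahler (map_poly of_int p) > 0" using mahler_int_ge_1[OF p(2)] by linarith
    then have "mahler (map_poly of_int p) \<le> exp B" using p by (metis exp_le_cancel_iff exp_ln)
    then show "x \<in> ?R" using p by blast
  qed
qed (intro finite_imageI finite_mahler_bounded)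

section \<open>Relative norms\<close>

text \<open>The roots in \<open>B\<close> are stripped off one at a time by
  \<open>algebraic_int_coeffs_remove_root\<close>.\<close>

lemma algebraic_int_coeffs_sub_roots:
  fixes c :: complex
  assumes "\<And>i. algebraic_int (coeff (Polynomial.smult c (\<Prod>x\<in>#A + B. [:- x, 1:])) i)"
  shows "algebraic_int (coeff (Polynomial.smult c (\<Prod>x\<in>#A. [:- x, 1:])) i)"
  using assms
proof (induction B arbitrary: i)
  case (add b B)
  have eq: "Polynomial.smult c (\<Prod>x\<in>#A + add_mset b B. [:- x, 1:])
      = [:- b, 1:] * Polynomial.smult c (\<Prod>x\<in>#A + B. [:- x, 1:])"
    by (simp add: mult_ac del: mult_pCons_left mult_pCons_right)
  have "algebraic_int (coeff (Polynomial.smult c (\<Prod>x\<in>#A + B. [:- x, 1:])) i)" for i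
    by (rule algebraic_int_coeffs_remove_root[of b], unfold eq[symmetric], rule add.prems)
  then show ?case by (rule add.IH)
qed simp

lemma algebraic_int_coeffs_root_subset:
  fixes p :: "int poly" and S :: "complex set"
  assumes p: "p \<noteq> 0" and S: "S \<subseteq> {x. poly (map_poly of_int p) x = 0}"
  shows "algebraic_int (coeff (Polynomial.smult (of_int (lead_coeff p)) (\<Prod>x\<in>S. [:- x, 1:])) i)"
proof -
  let ?p = "map_poly of_int p :: complex poly"
  have "finite S" using p S by (intro finite_subset[OF S] poly_roots_finite) auto
  have p0: "?p \<noteq> 0" using p by simp
  have sub: "mset_set S \<subseteq># proots ?p"
  proof (rule mset_subset_eqI)
    fix x show "count (mset_set S) x \<le> count (proots ?p) x"
    proof (cases "x \<in> S")
      case True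
      then have "x \<in># proots ?p" using S p0 by auto
      then show ?thesis using True \<open>finite S\<close> by simp
    qed simp
  qed
  have alg: "algebraic_int (coeff ?p i)" for i by (simp add: coeff_map_poly algebraic_int_of_int)
  have eq: "?p = Polynomial.smult (of_int (lead_coeff p))
      (\<Prod>x\<in>#mset_set S + (proots ?p - mset_set S). [:- x, 1:])"
    using complex_poly_decompose_multiset[of ?p] sub
    by (simp add: degree_map_poly coeff_map_poly)
  have "algebraic_int (coeff (Polynomial.smult (of_int (lead_coeff p))
      (\<Prod>x\<in>#mset_set S. [:- x, 1:])) i)"
    by (rule algebraic_int_coeffs_sub_roots[of _ _ "proots ?p - mset_set S"], fold eq, rule alg)
  then show ?thesis by (simp add: prod_unfold_prod_mset)
qed

text \<open>Up to sign the number is the constant coefficient of the scaled product of linear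
  factors over \<open>S\<close>, whose coefficients are algebraic integers.\<close>

lemma algebraic_int_lead_coeff_times_roots:
  fixes p :: "int poly" and S :: "complex set"
  assumes "p \<noteq> 0" "S \<subseteq> {x. poly (map_poly of_int p) x = 0}"
  shows "algebraic_int (of_int (lead_coeff p) * \<Prod>S)"
proof -
  have "coeff (\<Prod>x\<in>S. [:- x, 1:]) 0 = (- 1) ^ card S * \<Prod>S"
    by (simp add: poly_prod prod_uminus flip: poly_0_coeff_0)
  then have "algebraic_int ((- 1) ^ card S * (of_int (lead_coeff p) * \<Prod>S))"
    using algebraic_int_coeffs_root_subset[OF assms, of 0] by (simp add: mult_ac)
  then show ?thesis by (cases "even (card S)") auto
qed

text \<open>Each coefficient is, up to sign, a sum of products over subsets of \<open>I\<close>. The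
  induction varies \<open>c\<close>, because splitting off the factor of index \<open>i\<close>
  produces the multiplier \<open>c * f i\<close>.\<close>

lemma algebraic_int_coeffs_linear_factors:
  fixes f :: "'a \<Rightarrow> complex"
  assumes "finite I" "\<And>J. J \<subseteq> I \<Longrightarrow> algebraic_int (c * (\<Prod>i\<in>J. f i))"
  shows "algebraic_int (c * coeff (\<Prod>i\<in>I. [:- f i, 1:]) k)"
  using assms
proof (induction I arbitrary: c k rule: finite_induct)
  case empty
  then show ?case using empty[of "{}"] by (auto simp: coeff_1)
next
  case (insert i I)
  let ?Q = "\<Prod>i\<in>I. [:- f i, 1:]"
  have 1: "algebraic_int (c * coeff ?Q k)" for k
    by (rule insert.IH) (use insert.prems in auto)
  have 2: "algebraic_int ((c * f i) * coeff ?Q k)" for k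
  proof (rule insert.IH)
    fix J assume J: "J \<subseteq> I"
    then have "finite J" "i \<notin> J" using insert.hyps finite_subset by auto
    then show "algebraic_int (c * f i * (\<Prod>i\<in>J. f i))"
      using insert.prems[of "insert i J"] J by (auto simp: mult.assoc)
  qed
  have "c * coeff (\<Prod>i\<in>insert i I. [:- f i, 1:]) k
      = - ((c * f i) * coeff ?Q k) + (case k of 0 \<Rightarrow> 0 | Suc j \<Rightarrow> c * coeff ?Q j)"
    using insert.hyps by (auto simp: coeff_pCons algebra_simps split: nat.splits)
  moreover have "algebraic_int \<dots>"
    by (intro algebraic_int_plus algebraic_int_minus 2) (auto split: nat.splits intro: 1)
  ultimately show ?case by simp
qed

lemma coeff_linear_factors_gal:
  assumes "finite I" "\<And>i. i \<in> I \<Longrightarrow> algebraic (f i)" "\<sigma> \<in> gal"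
  shows "algebraic (coeff (\<Prod>i\<in>I. [:- f i, 1:]) k)"
    and "\<sigma> (coeff (\<Prod>i\<in>I. [:- f i, 1:]) k) = coeff (\<Prod>i\<in>I. [:- \<sigma> (f i), 1:]) k"
proof -
  have "algebraic (coeff (\<Prod>i\<in>I. [:- f i, 1:]) k) \<and>
      \<sigma> (coeff (\<Prod>i\<in>I. [:- f i, 1:]) k) = coeff (\<Prod>i\<in>I. [:- \<sigma> (f i), 1:]) k"
    using assms(1,2)
  proof (induction I arbitrary: k rule: finite_induct)
    case empty
    then show ?case using gal_Rats[OF assms(3)] by (auto simp: coeff_1)
  next
    case (insert i I)
    let ?Q = "\<Prod>i\<in>I. [:- f i, 1:]"
    let ?e = "case k of 0 \<Rightarrow> 0 | Suc j \<Rightarrow> coeff ?Q j"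
    have eq: "coeff (\<Prod>i\<in>insert i I. [:- g i, 1:]) k
        = - (g i * coeff (\<Prod>i\<in>I. [:- g i, 1:]) k) +
          (case k of 0 \<Rightarrow> 0 | Suc j \<Rightarrow> coeff (\<Prod>i\<in>I. [:- g i, 1:]) j)" for g :: "_ \<Rightarrow> complex"
      using insert.hyps by (auto simp: coeff_pCons split: nat.splits)
    have fi: "algebraic (f i)" using insert.prems by auto
    have IH: "algebraic (coeff ?Q k)" "\<sigma> (coeff ?Q k) = coeff (\<Prod>i\<in>I. [:- \<sigma> (f i), 1:]) k" for k
      using insert by auto
    have e: "algebraic ?e" "\<sigma> ?e = (case k of 0 \<Rightarrow> 0 | Suc j \<Rightarrow> coeff (\<Prod>i\<in>I. [:- \<sigma> (f i), 1:]) j)"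
      using IH gal_Rats[OF assms(3), of 0] by (auto split: nat.splits)
    have m: "algebraic (f i * coeff ?Q k)" using fi IH by (intro algebraic_times)
    then have m': "algebraic (- (f i * coeff ?Q k))" by simp
    show ?case
      unfolding eq using algebraic_plus[OF m' e(1)] gal_add[OF assms(3) m' e(1)]
        gal_minus[OF assms(3) m] gal_mult[OF assms(3) fi IH(1)] IH(2) e(2) by simp
  qed
  then show "algebraic (coeff (\<Prod>i\<in>I. [:- f i, 1:]) k)"
    and "\<sigma> (coeff (\<Prod>i\<in>I. [:- f i, 1:]) k) = coeff (\<Prod>i\<in>I. [:- \<sigma> (f i), 1:]) k" by auto
qed

text \<open>Coefficients fixed by all automorphisms are rational, and rational algebraic integers
  are integers.\<close>

lemma int_poly_if_gal_invariant:
  assumes I: "finite I" "\<And>i. i \<in> I \<Longrightarrow> algebraic (f i)"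
    and int: "\<And>k. algebraic_int (coeff (Polynomial.smult (of_int c) (\<Prod>i\<in>I. [:- f i, 1:])) k)"
    and inv: "\<And>\<sigma>. \<sigma> \<in> gal \<Longrightarrow> (\<Prod>i\<in>I. [:- \<sigma> (f i), 1:]) = (\<Prod>i\<in>I. [:- f i, 1:])"
  obtains p :: "int poly"
    where "map_poly of_int p = Polynomial.smult (of_int c) (\<Prod>i\<in>I. [:- f i, 1:])"
proof -
  have "coeff (\<Prod>i\<in>I. [:- f i, 1:]) k \<in> \<rat>" for k
  proof (rule gal_fixed_imp_Rats)
    show "algebraic (coeff (\<Prod>i\<in>I. [:- f i, 1:]) k)"
      using coeff_linear_factors_gal(1)[OF I id_in_gal] .
    show "\<sigma> (coeff (\<Prod>i\<in>I. [:- f i, 1:]) k) = coeff (\<Prod>i\<in>I. [:- f i, 1:]) k" if "\<sigma> \<in> gal" for \<sigma>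
      using coeff_linear_factors_gal(2)[OF I that] inv[OF that] by simp
  qed
  then have "coeff (Polynomial.smult (of_int c) (\<Prod>i\<in>I. [:- f i, 1:])) k \<in> \<int>" for k
    by (intro rational_algebraic_int_is_int int) auto
  then obtain p where "Polynomial.smult (of_int c) (\<Prod>i\<in>I. [:- f i, 1:]) = map_poly of_int p"
    by (rule intpolyE)
  then show ?thesis using that by metis
qed

lemma degree_linear_factors: "finite I \<Longrightarrow> degree (\<Prod>i\<in>I. [:- f i, 1 :: complex:]) = card I"
  by (subst degree_prod_eq_sum_degree) auto

lemma lead_coeff_linear_factors: "lead_coeff (\<Prod>i\<in>I. [:- f i, 1 :: complex:]) = 1"
  by (simp add: lead_coeff_prod)

text \<open>The scaled product over the conjugates is an integer polynomial that vanishes at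
  \<open>a\<close>, hence a multiple of the minimal polynomial. All conjugates are roots of the
  latter, so comparing degrees and leading coefficients leaves the cofactor 1.\<close>

lemma int_minpoly_factorization:
  assumes a: "algebraic a"
  shows "map_poly of_int (int_minpoly a) =
    Polynomial.smult (of_int (lead_coeff (int_minpoly a))) (\<Prod>b\<in>orb gal a. [:- b, 1:])"
proof -
  let ?p = "int_minpoly a" and ?Q = "\<Prod>b\<in>orb gal a. [:- b, 1:]"
  note p0 = int_minpoly_nonzero[OF a]
  have sub: "orb gal a \<subseteq> {x. poly (map_poly of_int ?p) x = 0}"
    using gal_int_root[OF _ a int_minpoly_root[OF a]] by (auto elim: orbE)
  have inv: "(\<Prod>b\<in>orb gal a. [:- \<sigma> b, 1:]) = ?Q" if \<sigma>: "\<sigma> \<in> gal" for \<sigma>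
  proof -
    have "inj_on \<sigma> (orb gal a)" using gal_inj[OF \<sigma>] by (auto intro: inj_onI)
    moreover from this have "\<sigma> ` orb gal a = orb gal a"
      using gal_image_orb_gal[OF \<sigma>] by (intro endo_inj_surj finite_orb_gal a) auto
    ultimately show ?thesis using prod.reindex[of \<sigma> "orb gal a" "\<lambda>b. [:- b, 1:]"] by (simp add: o_def)
  qed
  obtain q :: "int poly" where q: "map_poly of_int q = Polynomial.smult (of_int (lead_coeff ?p)) ?Q"
  proof (rule int_poly_if_gal_invariant[of "orb gal a" "\<lambda>b. b"])
    show "finite (orb gal a)" by (rule finite_orb_gal[OF a])
    show "algebraic b" if "b \<in> orb gal a" for b using that orb_algebraic a by blast
    show "algebraic_int (coeff (Polynomial.smult (of_int (lead_coeff ?p)) ?Q) k)" for k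
      by (rule algebraic_int_coeffs_root_subset[OF p0 sub])
  qed (use inv in auto)
  have lq: "lead_coeff q = lead_coeff ?p"
  proof -
    have "of_int (lead_coeff q) = lead_coeff (map_poly of_int q :: complex poly)"
      by (simp add: degree_map_poly coeff_map_poly)
    also have "\<dots> = of_int (lead_coeff ?p)"
      unfolding q lead_coeff_smult lead_coeff_linear_factors by simp
    finally show ?thesis using of_int_eq_iff by blast
  qed
  have q0: "q \<noteq> 0" using lq p0 by auto
  have "poly ?Q a = 0"
    using orb_self[OF id_in_gal, of a] finite_orb_gal[OF a] by (auto simp: poly_prod)
  then have "poly (map_poly of_int q) a = 0" unfolding q by simp
  then obtain s where s: "q = ?p * s" using int_minpoly_dvd[OF a] by blast
  have "lead_coeff s = 1" using lq lead_coeff_mult[of ?p s] p0 by (simp add: s)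
  moreover have "degree q \<le> degree ?p"
  proof -
    have "degree q = degree (map_poly of_int q :: complex poly)" by (simp add: degree_map_poly)
    also have "\<dots> = card (orb gal a)"
      unfolding q using p0 by (simp add: degree_linear_factors finite_orb_gal[OF a])
    also have "\<dots> \<le> card {x :: complex. poly (map_poly of_int ?p) x = 0}"
      using p0 by (intro card_mono sub poly_roots_finite) auto
    also have "\<dots> \<le> degree ?p"
      using card_poly_roots_bound[of "map_poly of_int ?p :: complex poly"] p0 by (simp add: degree_map_poly)
    finally show ?thesis .
  qed
  then have "degree s = 0" using s q0 p0 by (auto simp: degree_mult_eq)
  ultimately have "s = 1" by (auto elim!: degree_eq_zeroE)
  then show ?thesis using s q by simp
qed

lemma mahler_int_minpoly:
  assumes "algebraic a"
  shows "mahler (map_poly of_int (int_minpoly a)) =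
    real_of_int (lead_coeff (int_minpoly a)) * (\<Prod>b\<in>orb gal a. max 1 (cmod b))"
  using lead_coeff_int_minpoly[OF assms]
  by (simp add: int_minpoly_factorization[OF assms] mahler_smult mahler_prod mahler_linear finite_orb_gal[OF assms])

section \<open>Block polynomials and roots of relative norms\<close>

context finite_index_normal
begin

text \<open>The characteristic polynomial of the relative norms of the conjugates of \<open>a\<close>, scaled by the
  leading coefficient of the minimal polynomial so that it becomes integral.\<close>

definition block_poly :: "complex \<Rightarrow> complex poly" where
  "block_poly a = Polynomial.smult (of_int (lead_coeff (int_minpoly a))) (\<Prod>B\<in>blocks a. [:- \<Prod>B, 1:])"

text \<open>Automorphisms permute the blocks, which makes the coefficients rational. They are
  integral because the product over several blocks is a product of distinct conjugates of
  \<open>a\<close>, and the leading coefficient turns it into an algebraic integer.\<close>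

lemma block_poly_int:
  assumes a: "algebraic a"
  obtains P :: "int poly" where "map_poly of_int P = block_poly a"
  unfolding block_poly_def
proof (rule int_poly_if_gal_invariant[of "blocks a" "\<lambda>B. \<Prod>B"])
  let ?p = "int_minpoly a"
  show "finite (blocks a)" by (rule finite_blocks)
  show "algebraic (\<Prod>B)" if "B \<in> blocks a" for B
    using that by (intro algebraic_prod) (auto intro: block_algebraic[OF a])
  show "(\<Prod>B\<in>blocks a. [:- \<sigma> (\<Prod>B), 1:]) = (\<Prod>B\<in>blocks a. [:- \<Prod>B, 1:])" if \<sigma>: "\<sigma> \<in> gal" for \<sigma>
  proof -
    have "\<sigma> (\<Prod>B) = \<Prod>(\<sigma> ` B)" if "B \<in> blocks a" for B
    proof -
      have "\<sigma> (\<Prod>B) = (\<Prod>b\<in>B. \<sigma> b)"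
        using that by (intro gal_prod \<sigma>) (auto intro: block_algebraic[OF a])
      also have "\<dots> = \<Prod>(\<sigma> ` B)"
        using gal_inj[OF \<sigma>] by (subst prod.reindex) (auto intro: inj_onI)
      finally show ?thesis .
    qed
    then have "(\<Prod>B\<in>blocks a. [:- \<sigma> (\<Prod>B), 1:]) = (\<Prod>B\<in>blocks a. [:- \<Prod>(\<sigma> ` B), 1:])"
      by (intro prod.cong) auto
    also have "\<dots> = (\<Prod>B\<in>blocks a. [:- \<Prod>B, 1:])"
      by (rule prod.reindex_bij_betw[OF bij_betw_blocks[OF \<sigma>]])
    finally show ?thesis .
  qed
  show "algebraic_int (coeff (Polynomial.smult (of_int (lead_coeff ?p)) (\<Prod>B\<in>blocks a. [:- \<Prod>B, 1:])) k)" for k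
    unfolding coeff_smult
  proof (rule algebraic_int_coeffs_linear_factors[OF finite_blocks])
    fix J assume J: "J \<subseteq> blocks a"
    have "(\<Prod>B\<in>J. \<Prod>B) = \<Prod>(\<Union>J)"
      using prod.Union_disjoint[of J "\<lambda>b. b"] J blocks_disjoint[of _ a] finite_block[OF a]
      by (auto simp: subset_iff)
    moreover have "\<Union>J \<subseteq> orb gal a" using J Union_blocks[of a] by blast
    then have "\<Union>J \<subseteq> {x. poly (map_poly of_int ?p) x = 0}"
      using gal_int_root[OF _ a int_minpoly_root[OF a]] by (blast elim: orbE)
    ultimately show "algebraic_int (of_int (lead_coeff ?p) * (\<Prod>B\<in>J. \<Prod>B))"
      using algebraic_int_lead_coeff_times_roots[OF int_minpoly_nonzero[OF a]] by simp
  qed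
qed

lemma block_poly_nonzero: "algebraic a \<Longrightarrow> block_poly a \<noteq> 0"
  using lead_coeff_linear_factors[of "\<lambda>B. \<Prod>B" "blocks a"] int_minpoly_nonzero[of a]
  by (auto simp: block_poly_def)

lemma degree_block_poly: "degree (block_poly a) \<le> card F"
  using card_blocks[of a] by (simp add: block_poly_def degree_linear_factors[OF finite_blocks])

lemma mahler_block_poly:
  assumes "algebraic a"
  shows "mahler (block_poly a) =
    real_of_int (lead_coeff (int_minpoly a)) * (\<Prod>B\<in>blocks a. max 1 (cmod (\<Prod>B)))"
  using lead_coeff_int_minpoly[OF assms]
  by (simp add: block_poly_def mahler_smult mahler_prod[OF finite_blocks] mahler_linear)

text \<open>Within each block \<open>max 1\<close> is submultiplicative, and the blocks partition
  the conjugates of \<open>a\<close>.\<close>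

lemma mahler_block_poly_le:
  assumes a: "algebraic a"
  shows "mahler (block_poly a) \<le> mahler (map_poly of_int (int_minpoly a))"
proof -
  have "max 1 (cmod (\<Prod>B)) \<le> (\<Prod>b\<in>B. max 1 (cmod b))" for B :: "complex set"
    using prod_mono[of B cmod "\<lambda>b. max 1 (cmod b)"] prod_ge_1[of B "\<lambda>b. max 1 (cmod b)"]
    by (auto simp: prod_norm[symmetric])
  then have "(\<Prod>B\<in>blocks a. max 1 (cmod (\<Prod>B))) \<le> (\<Prod>B\<in>blocks a. \<Prod>b\<in>B. max 1 (cmod b))"
    by (intro prod_mono) (auto simp: le_max_iff_disj)
  then show ?thesis
    unfolding mahler_block_poly[OF a] mahler_int_minpoly[OF a] prod_blocks[OF a]
    using lead_coeff_int_minpoly[OF a] by (intro mult_left_mono) auto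
qed

text \<open>If a power of \<open>a\<close> is fixed by \<open>H\<close>, the elements of a block differ by roots of unity.\<close>

lemma mahler_block_poly_eq:
  assumes a: "algebraic a" and k: "k > 0" "\<And>h. h \<in> H \<Longrightarrow> h (a ^ k) = a ^ k"
  shows "mahler (block_poly a) = mahler (map_poly of_int (int_minpoly a))"
proof -
  have "max 1 (cmod (\<Prod>B)) = (\<Prod>b\<in>B. max 1 (cmod b))" if B: "B \<in> blocks a" for B
  proof -
    obtain \<sigma> where \<sigma>: "\<sigma> \<in> gal" "B = \<sigma> ` orb H a" using block_image[OF B] by blast
    define r where "r = cmod (\<sigma> a)"
    have r: "cmod b = r" if b: "b \<in> B" for b
    proof -
      obtain h where h: "h \<in> H" "b = \<sigma> (h a)" using b \<sigma> by (auto elim: orbE)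
      have ha: "algebraic (h a)" using gal_algebraic_iff[OF H_in_gal[OF h(1)]] a by simp
      have "b ^ k = \<sigma> (h a ^ k)" using h gal_power[OF \<sigma>(1) ha] by simp
      also have "h a ^ k = a ^ k" using k(2)[OF h(1)] gal_power[OF H_in_gal[OF h(1)] a] by simp
      finally have "cmod b ^ k = r ^ k" using gal_power[OF \<sigma>(1) a] by (simp add: r_def flip: norm_power)
      then show ?thesis using k(1) by (simp add: power_eq_iff_eq_base r_def)
    qed
    have "max 1 (cmod (\<Prod>B)) = max 1 (r ^ card B)" using r by (simp add: prod_norm[symmetric])
    also have "\<dots> = (\<Prod>b\<in>B. max 1 (cmod b))" using r by (simp add: max_1_power r_def)
    finally show ?thesis .
  qed
  then show ?thesis
    unfolding mahler_block_poly[OF a] mahler_int_minpoly[OF a] prod_blocks[OF a, symmetric]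
    by (simp cong: prod.cong)
qed

lemma log_mahler_norm_root_le:
  assumes a: "algebraic a" and \<beta>: "\<beta> ^ card (orb H a) = \<Prod>(orb H a)"
  shows "algebraic \<beta>" "log_mahler \<beta> \<le> log_mahler a"
proof -
  define d where "d = card (orb H a)"
  have d: "d > 0" using finite_orb[OF a] orb_self[OF id_H, of a] by (auto simp: d_def card_gt_0_iff)
  show alg: "algebraic \<beta>"
  proof (rule algebraic_if_power[OF _ d])
    have "algebraic (\<Prod>(orb H a))" by (rule algebraic_prod) (rule orb_algebraic[OF H_gal a])
    then show "algebraic (\<beta> ^ d)" using \<beta> by (simp add: d_def)
  qed
  \<comment> \<open>\<open>R\<close> is an integer polynomial with the Mahler measure of
    \<open>block_poly a\<close>. It vanishes at \<open>\<beta>\<close> through the factor belonging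
    to the block \<open>orb H a\<close>.\<close>
  define R where "R = block_poly a \<circ>\<^sub>p monom 1 d"
  have R_eq: "R = Polynomial.smult (of_int (lead_coeff (int_minpoly a))) (\<Prod>B\<in>blocks a. monom 1 d - [:\<Prod>B:])"
  proof -
    have "[:- \<delta>, 1:] \<circ>\<^sub>p monom 1 d = monom 1 d - [:\<delta>:]" for \<delta> :: complex
      by (rule poly_eqI) (simp add: pcompose_pCons coeff_pCons split: nat.splits)
    then show ?thesis unfolding R_def block_poly_def pcompose_smult pcompose_prod by (simp only:)
  qed
  obtain P :: "int poly" where P: "map_poly of_int P = block_poly a" using block_poly_int[OF a] .
  have "coeff R i \<in> \<int>" for i
    unfolding R_def P[symmetric]
    by (rule coeff_pcompose_semiring_closed) (auto simp: coeff_map_poly)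
  then obtain q where q: "R = map_poly of_int q" by (rule intpolyE)
  have mR: "mahler R = mahler (block_poly a)"
    unfolding R_eq mahler_block_poly[OF a] using lead_coeff_int_minpoly[OF a]
    by (simp add: mahler_smult mahler_prod[OF finite_blocks] mahler_power_minus_const[OF d])
  have R0: "R \<noteq> 0"
    unfolding R_eq using power_minus_const(3)[OF d] int_minpoly_nonzero[OF a] finite_blocks by simp
  have "poly R \<beta> = 0"
    unfolding R_eq using orb_in_blocks[of a] finite_blocks[of a] \<beta>
    by (auto simp: poly_prod poly_monom d_def)
  then have "log_mahler \<beta> \<le> ln (mahler R)"
    using log_mahler_le[OF alg, of q] R0 unfolding q by auto
  also have "\<dots> \<le> log_mahler a"
  proof -
    have "mahler R \<ge> 1" unfolding q using mahler_int_ge_1[of q] R0 q by auto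
    then show ?thesis unfolding log_mahler_eq[OF a] mR using mahler_block_poly_le[OF a] by simp
  qed
  finally show "log_mahler \<beta> \<le> log_mahler a" .
qed

text \<open>The minimal polynomial of \<open>a\<close> may have large degree, but the block
  polynomial has the same measure and degree at most \<open>card F\<close>.\<close>

lemma log_mahler_fixed_power_value:
  assumes a: "algebraic a" and k: "k > 0" "\<And>h. h \<in> H \<Longrightarrow> h (a ^ k) = a ^ k"
  shows "log_mahler a \<in> mahler_values (card F)"
proof -
  obtain P :: "int poly" where P: "map_poly of_int P = block_poly a" using block_poly_int[OF a] .
  have "log_mahler a = ln (mahler (map_poly of_int P))"
    by (simp add: log_mahler_eq[OF a] P mahler_block_poly_eq[of a k] a k)
  moreover have "P \<noteq> 0" using P block_poly_nonzero[OF a] by auto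
  moreover have "degree P \<le> card F"
    using degree_block_poly[of a] unfolding P[symmetric] by (simp add: degree_map_poly)
  ultimately show ?thesis unfolding mahler_values_def by blast
qed

end

section \<open>Minimal factorizations\<close>

lemma complex_nth_root_exists: "d > 0 \<Longrightarrow> \<exists>z :: complex. z ^ d = \<delta>"
  using poly_root_exists_complex[of "monom 1 d - [:\<delta>:]"] power_minus_const(1)[of d \<delta>]
  by (auto simp: poly_monom)

text \<open>\<open>D\<close> depends on \<open>\<alpha>\<close> alone, and one refined factorization
  serves all exponents at once. The infimum is thereby restricted to factors whose measures lie in a
  set with finitely many elements below any bound.\<close>

lemma refine_factorization:
  assumes \<alpha>: "algebraic \<alpha>" "\<alpha> \<noteq> 0"
  obtains D where "\<And>as. as \<in> factorizations \<alpha> \<Longrightarrow>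
    \<exists>bs\<in>factorizations \<alpha>. (\<forall>b\<in>set bs. log_mahler b \<in> mahler_values D) \<and>
      (\<forall>t>0. (\<Sum>b\<leftarrow>bs. log_mahler b powr t) \<le> (\<Sum>a\<leftarrow>as. log_mahler a powr t))"
proof -
  obtain F where "finite_index_normal (galfix (orb gal \<alpha>)) F"
    using finite_index_normal_galfix[of "orb gal \<alpha>"] finite_orb_gal[OF \<alpha>(1)] gal_image_orb_gal by blast
  then interpret finite_index_normal "galfix (orb gal \<alpha>)" F .
  let ?H = "galfix (orb gal \<alpha>)" and ?S = "mahler_values (card F)"
  have fix_\<alpha>: "h \<alpha> = \<alpha>" if "h \<in> ?H" for h
    using that orb_self[OF id_in_gal, of \<alpha>] by (auto simp: galfix_def)
  \<comment> \<open>The correcting root of unity below has measure 0, so 0 must be an admissible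
    value.\<close>
  have zero: "0 \<in> ?S"
    unfolding mahler_values_def by (rule CollectI, rule exI[of _ "1 :: int poly"]) (simp add: mahler_def)
  have "\<exists>bs\<in>factorizations \<alpha>. (\<forall>b\<in>set bs. log_mahler b \<in> ?S) \<and>
      (\<forall>t>0. (\<Sum>b\<leftarrow>bs. log_mahler b powr t) \<le> (\<Sum>a\<leftarrow>as. log_mahler a powr t))"
    if as: "as \<in> factorizations \<alpha>" for as
  proof -
    have alg: "algebraic a" if "a \<in> set as" for a using as that by (auto simp: factorizations_def)
    have prod_as: "prod_list as = \<alpha>" using as by (auto simp: factorizations_def)
    have pos: "card (orb ?H a) > 0" if "algebraic a" for a
      using finite_orb[OF that] orb_self[OF id_H, of a] by (auto simp: card_gt_0_iff)
    have "\<forall>a. \<exists>z. a \<in> set as \<longrightarrow> z ^ card (orb ?H a) = \<Prod>(orb ?H a)"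
      using complex_nth_root_exists pos alg by metis
    then obtain \<beta> where \<beta>: "\<And>a. a \<in> set as \<Longrightarrow> \<beta> a ^ card (orb ?H a) = \<Prod>(orb ?H a)" by metis
    obtain m where m: "m > 0" "prod_list (map \<beta> as) ^ m = \<alpha> ^ m"
      using tuple_norm[of \<alpha> as \<beta>] fix_\<alpha> alg prod_as \<beta> by blast
    \<comment> \<open>The numbers \<open>\<beta> a\<close> multiply to \<open>\<alpha>\<close> only
      up to a root of unity; taking it as an extra factor restores the product at no cost.\<close>
    define \<zeta> where "\<zeta> = \<alpha> / prod_list (map \<beta> as)"
    have nz: "prod_list (map \<beta> as) \<noteq> 0" using m \<alpha>(2) by (metis power_eq_0_iff)
    have "\<zeta> ^ m = 1" using m(2) \<alpha>(2) by (simp add: \<zeta>_def power_divide)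
    note \<zeta> = log_mahler_root_of_unity[OF this m(1)]
    have \<beta>_alg: "algebraic (\<beta> a)" and \<beta>_le: "log_mahler (\<beta> a) \<le> log_mahler a" if "a \<in> set as" for a
      using log_mahler_norm_root_le[OF alg[OF that] \<beta>[OF that]] by auto
    \<comment> \<open>The power of \<open>\<beta> a\<close> with the orbit size as exponent is a
      relative norm, hence fixed by \<open>?H\<close>.\<close>
    have \<beta>_val: "log_mahler (\<beta> a) \<in> ?S" if "a \<in> set as" for a
      using log_mahler_fixed_power_value[OF \<beta>_alg[OF that] pos[OF alg[OF that]]]
        \<beta>[OF that] orb_prod_fixed[OF alg[OF that]] by simp
    let ?bs = "\<zeta> # map \<beta> as"
    have "?bs \<in> factorizations \<alpha>"
      unfolding factorizations_def using \<zeta>(1) \<beta>_alg nz \<alpha>(2) by (auto simp: \<zeta>_def prod_list_zero_iff)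
    moreover have "\<forall>b\<in>set ?bs. log_mahler b \<in> ?S" using zero \<zeta>(2) \<beta>_val by auto
    moreover have "(\<Sum>b\<leftarrow>?bs. log_mahler b powr t) \<le> (\<Sum>a\<leftarrow>as. log_mahler a powr t)" if "t > 0" for t
      using \<beta>_le \<beta>_alg that
      by (auto simp: \<zeta>(2) o_def intro!: sum_list_mono powr_mono2 log_mahler_nonneg)
    ultimately show ?thesis by blast
  qed
  then show ?thesis using that by blast
qed

section \<open>From lists of measures to finitely supported sequences\<close>

lemma sum_powr_filter_nonzero:
  "(\<Sum>y\<leftarrow>filter (\<lambda>y. y \<noteq> 0) ys. y powr t) = (\<Sum>y\<leftarrow>ys. (y :: real) powr t)"
  by (induction ys) auto

lemma member_powr_le_sum_list:
  "y \<in> set ys \<Longrightarrow> (y :: real) powr t \<le> (\<Sum>y\<leftarrow>ys. y powr t)"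
  by (rule member_le_sum_list) auto

definition list_seq :: "real list \<Rightarrow> nat \<Rightarrow> real" where
  "list_seq ys n = (if n < length ys then ys ! n else 0)"

lemma seq_norm_list_seq:
  assumes "\<And>y. y \<in> set ys \<Longrightarrow> y > 0"
  shows "seq_norm t (list_seq ys) = (\<Sum>y\<leftarrow>ys. y powr t) powr (1 / t)"
proof -
  have pos: "ys ! n > 0" if "n < length ys" for n using assms that by simp
  have "{n. list_seq ys n \<noteq> 0} = {0..<length ys}"
    using pos by (force simp: list_seq_def)
  moreover have "(\<Sum>n = 0..<length ys. \<bar>list_seq ys n\<bar> powr t) = (\<Sum>y\<leftarrow>ys. y powr t)"
    unfolding sum.list_conv_set_nth using pos by (intro sum.cong) (simp_all add: list_seq_def less_imp_le)
  ultimately show ?thesis by (simp add: seq_norm_def)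
qed

theorem theorem4p1:
  fixes \<alpha> :: complex and T :: real
  assumes "algebraic \<alpha>" and "\<alpha> \<noteq> 0" and "T > 0"
  shows "\<exists>X. X \<subseteq> fin_supp_seqs \<and> finite X \<and> X \<noteq> {} \<and>
           (\<forall>t\<in>{0<..T}. metric_mahler t \<alpha> = Min (seq_norm t ` X))"
proof -
  define val where "val t as = (\<Sum>a\<leftarrow>as. log_mahler a powr t) powr (1 / t)" for t as
  define nz where "nz as = filter (\<lambda>y. y \<noteq> 0) (map log_mahler as)" for as
  obtain D where refine: "\<And>as. as \<in> factorizations \<alpha> \<Longrightarrow>
    \<exists>bs\<in>factorizations \<alpha>. (\<forall>b\<in>set bs. log_mahler b \<in> mahler_values D) \<and>
      (\<forall>t>0. (\<Sum>b\<leftarrow>bs. log_mahler b powr t) \<le> (\<Sum>a\<leftarrow>as. log_mahler a powr t))"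
    using refine_factorization[OF assms(1,2)] by blast
  define M where "M = log_mahler \<alpha>"
  have M: "M \<ge> 0" using log_mahler_nonneg[OF assms(1)] by (simp add: M_def)
  define V where "V = mahler_values D \<inter> {..M} \<inter> {0<..}"
  have finV: "finite V"
    unfolding V_def by (rule finite_Int) (rule disjI1, rule finite_mahler_values)
  \<comment> \<open>Inserting 1 keeps \<open>Min\<close> meaningful when \<open>V\<close> is
    empty.\<close>
  define c where "c = Min (insert 1 V)"
  have c: "c > 0" "\<And>v. v \<in> V \<Longrightarrow> c \<le> v" using finV by (auto simp: c_def V_def)
  \<comment> \<open>If \<open>n\<close> entries are at least \<open>c\<close> and their powers sum
    to at most \<open>M powr t\<close>, then \<open>n \<le> (M / c) powr t\<close>. The maximum with
    1 makes the bound monotone in \<open>t\<close>, so its value at \<open>T\<close> covers every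
    exponent.\<close>
  define N where "N = nat \<lfloor>max 1 (M / c) powr T\<rfloor>"
  \<comment> \<open>Only lists coming from actual factorizations are kept, so each resulting norm is
    an upper bound for the infimum.\<close>
  define Y where "Y = nz ` factorizations \<alpha> \<inter> {ys. set ys \<subseteq> V \<and> length ys \<le> N}"
  define X where "X = list_seq ` Y"
  have nz_pos: "y > 0" if "as \<in> factorizations \<alpha>" "y \<in> set (nz as)" for as y
    using that log_mahler_nonneg by (force simp: nz_def factorizations_def)
  have norm_nz: "seq_norm t (list_seq (nz as)) = val t as" if "as \<in> factorizations \<alpha>" for as t
    using seq_norm_list_seq[of "nz as" t, OF nz_pos[OF that]] sum_powr_filter_nonzero[of t "map log_mahler as"]
    by (simp add: val_def nz_def o_def)
  have finX: "finite X"
    unfolding X_def Y_def using finite_lists_length_le[OF finV, of N] by (intro finite_imageI) auto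
  have Xsub: "X \<subseteq> fin_supp_seqs"
  proof
    fix x assume "x \<in> X"
    then obtain ys where x: "x = list_seq ys" by (auto simp: X_def)
    have "{n. x n \<noteq> 0} \<subseteq> {..<length ys}" by (auto simp: x list_seq_def split: if_splits)
    then show "x \<in> fin_supp_seqs" unfolding fin_supp_seqs_def using finite_subset by blast
  qed
  have triv: "[\<alpha>] \<in> factorizations \<alpha>" using assms by (simp add: factorizations_def)
  have approx: "\<exists>x\<in>X. seq_norm t x \<le> val t as" if t: "0 < t" "t \<le> T" and as: "as \<in> factorizations \<alpha>" for t as
  proof -
    \<comment> \<open>A factorization that loses against the trivial one at this \<open>t\<close> is
      replaced by the trivial one, so that the sum is at most \<open>M powr t\<close>.\<close>
    define as' where "as' = (if (\<Sum>a\<leftarrow>as. log_mahler a powr t) \<le> M powr t then as else [\<alpha>])"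
    have as': "as' \<in> factorizations \<alpha>" using as triv by (simp add: as'_def)
    have le1: "(\<Sum>a\<leftarrow>as'. log_mahler a powr t) \<le> (\<Sum>a\<leftarrow>as. log_mahler a powr t)"
      and le2: "(\<Sum>a\<leftarrow>as'. log_mahler a powr t) \<le> M powr t" by (auto simp: as'_def M_def)
    obtain bs where bs: "bs \<in> factorizations \<alpha>" "\<forall>b\<in>set bs. log_mahler b \<in> mahler_values D"
      and le3: "(\<Sum>b\<leftarrow>bs. log_mahler b powr t) \<le> (\<Sum>a\<leftarrow>as'. log_mahler a powr t)"
      using refine[OF as'] t(1) by blast
    have sum_nz: "(\<Sum>y\<leftarrow>nz bs. y powr t) \<le> M powr t"
      using sum_powr_filter_nonzero[of t "map log_mahler bs"] le2 le3 by (simp add: nz_def o_def)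
    have V: "set (nz bs) \<subseteq> V"
    proof
      fix y assume y: "y \<in> set (nz bs)"
      have "y powr t \<le> M powr t" using member_powr_le_sum_list[OF y, of t] sum_nz by linarith
      then have "y \<le> M" using powr_less_mono2[OF t(1) M, of y] by linarith
      then show "y \<in> V" using y nz_pos[OF bs(1) y] bs(2) by (auto simp: V_def nz_def)
    qed
    have "length (nz bs) \<le> N"
    proof -
      have "real (length (nz bs)) * c powr t = (\<Sum>y\<leftarrow>nz bs. c powr t)"
        by (simp add: sum_list_triv)
      also have "\<dots> \<le> (\<Sum>y\<leftarrow>nz bs. y powr t)"
        using V c t(1) by (intro sum_list_mono powr_mono2) auto
      also have "\<dots> \<le> M powr t" by (rule sum_nz)
      finally have "real (length (nz bs)) \<le> M powr t / c powr t" using c(1) by (simp add: field_simps)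
      also have "\<dots> = (M / c) powr t" using M c(1) by (simp add: powr_divide)
      also have "\<dots> \<le> max 1 (M / c) powr t" using M c(1) t(1) by (intro powr_mono2) auto
      also have "\<dots> \<le> max 1 (M / c) powr T" using t(2) by (intro powr_mono) auto
      finally show ?thesis unfolding N_def by linarith
    qed
    then have "list_seq (nz bs) \<in> X" using V bs(1) by (auto simp: X_def Y_def)
    moreover have "seq_norm t (list_seq (nz bs)) \<le> val t as"
      unfolding norm_nz[OF bs(1)] val_def
      using le1 le3 t(1) by (intro powr_mono2) (auto intro!: sum_list_nonneg)
    ultimately show ?thesis by blast
  qed
  \<comment> \<open>The trivial factorization at exponent \<open>T\<close> supplies an
    element.\<close>
  have Xne: "X \<noteq> {}" using approx[of T, OF assms(3) order_refl triv] by blast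
  have "metric_mahler t \<alpha> = Min (seq_norm t ` X)" if t: "t \<in> {0<..T}" for t
  proof (rule antisym)
    have bdd: "bdd_below (val t ` factorizations \<alpha>)"
      by (rule bdd_belowI[of _ 0]) (auto simp: val_def)
    have mm: "metric_mahler t \<alpha> = (INF as\<in>factorizations \<alpha>. val t as)"
      by (simp add: metric_mahler_def val_def)
    have "metric_mahler t \<alpha> \<le> y" if "y \<in> seq_norm t ` X" for y
    proof -
      obtain as where "as \<in> factorizations \<alpha>" "y = seq_norm t (list_seq (nz as))"
        using \<open>y \<in> seq_norm t ` X\<close> by (auto simp: X_def Y_def)
      then show ?thesis unfolding mm using cINF_lower[OF bdd] norm_nz by simp
    qed
    then show "metric_mahler t \<alpha> \<le> Min (seq_norm t ` X)" using finX Xne by simp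
    show "Min (seq_norm t ` X) \<le> metric_mahler t \<alpha>"
      unfolding mm
    proof (rule cINF_greatest)
      show "factorizations \<alpha> \<noteq> {}" using triv by blast
      fix as assume "as \<in> factorizations \<alpha>"
      then obtain x where "x \<in> X" "seq_norm t x \<le> val t as" using approx t by auto
      moreover from this have "Min (seq_norm t ` X) \<le> seq_norm t x" using finX by (intro Min_le) auto
      ultimately show "Min (seq_norm t ` X) \<le> val t as" by linarith
    qed
  qed
  then show ?thesis using Xsub finX Xne by blast
qed

end
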